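(* Let $M\subset\mathbb{D}^n$ be an oriented non-degenerate Lagrangian submanifold which is connected. Then $M$ is a minimal (mean curvature zero) submanifold if and only if $M$ has constant phase.
   Context: $\mathbb{D}$ denotes the double numbers: the real algebra generated by $1,\tau$ with $\tau^2=1$; $e^{\tau\theta}=\cosh\theta+\tau\sinh\theta$ for $\theta\in\mathbb{R}$. $\mathbb{D}^n=\mathbb{R}^n\oplus\tau\mathbb{R}^n$ has coordinates $z_j=x_j+\tau y_j$, the inner product of signature $(n,n)$ with quadratic form $\langle z,z\rangle=\sum_j(x_j^2-y_j^2)$, the symplectic form $\omega=\sum_jdx_j\wedge dy_j$, and the $\mathbb{D}$-valued $n$-form $dz=dz_1\wedge\cdots\wedge dz_n$, $dz_j=dx_j+\tau dy_j$. An oriented smooth $n$-dimensional submanifold $M$ is non-degenerate Lagrangian if $\omega|_M=0$ and $\langle\cdot,\cdot\rangle$ restricts to a non-degenerate form on each tangent space. If $M$ is connected, the restricted metric has constant signature $(p,q)$, $p+q=n$, and there is a sign $\pm$ (determined by the orientation) and a smooth function $\theta:M\to\mathbb{R}$, called the phase function, with $$\pm\tau^q\,dz|_M=e^{\tau\theta}\,d\mathrm{vol}_M,$$ where $d\mathrm{vol}_M$ is the positive unit volume form of the oriented manifold $M$ (value $1$ on oriented orthonormal bases, i.e. bases with $\langle e_i,e_j\rangle=\pm\delta_{ij}$). $M$ has constant phase if $\theta$ is constant. The mean curvature vector is the trace, with respect to the induced metric, of the second fundamental form of $M$ in the flat semi-Riemannian space $\mathbb{D}^n$. *)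

theory Defs
  imports "HOL-Analysis.Analysis"
begin

section \<open>The double numbers\<close>

codatatype double = Double (xpart: real) (ypart: real)

lemma double_eq_iff: "z = w \<longleftrightarrow> xpart z = xpart w \<and> ypart z = ypart w"
  by (auto intro: double.expand)

instantiation double :: comm_ring_1
begin

primcorec zero_double where
  "xpart 0 = 0"
| "ypart 0 = 0"

primcorec one_double where
  "xpart 1 = 1"
| "ypart 1 = 0"

primcorec plus_double where
  "xpart (z + w) = xpart z + xpart w"
| "ypart (z + w) = ypart z + ypart w"

primcorec uminus_double where
  "xpart (- z) = - xpart z"
| "ypart (- z) = - ypart z"

primcorec minus_double where
  "xpart (z - w) = xpart z - xpart w"
| "ypart (z - w) = ypart z - ypart w"

primcorec times_double where
  "xpart (z * w) = xpart z * xpart w + ypart z * ypart w"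
| "ypart (z * w) = xpart z * ypart w + ypart z * xpart w"

instance
  by standard (simp_all add: double_eq_iff algebra_simps)

end

instantiation double :: real_algebra_1
begin

primcorec scaleR_double where
  "xpart (r *\<^sub>R z) = r * xpart z"
| "ypart (r *\<^sub>R z) = r * ypart z"

instance
  by standard (simp_all add: double_eq_iff algebra_simps)

end

text \<open>
  The positive definite inner product on the double numbers only serves to fix the usual
  topology and differential calculus of the plane. It is unrelated to the indefinite form
  \<open>ip\<close> below, with respect to which all the geometry is done.
\<close>

instantiation double :: euclidean_space
begin

definition inner_double :: "double \<Rightarrow> double \<Rightarrow> real" where
  "inner_double z w = xpart z * xpart w + ypart z * ypart w"

definition norm_double :: "double \<Rightarrow> real" where
  "norm_double z = sqrt (inner z z)"

definition sgn_double :: "double \<Rightarrow> double" where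
  "sgn_double z = z /\<^sub>R norm z"

definition dist_double :: "double \<Rightarrow> double \<Rightarrow> real" where
  "dist_double z w = norm (z - w)"

definition uniformity_double :: "(double \<times> double) filter" where
  "uniformity_double = (INF e\<in>{0 <..}. principal {(z, w). dist z w < e})"

definition open_double :: "double set \<Rightarrow> bool" where
  "open_double U \<longleftrightarrow> (\<forall>z\<in>U. eventually (\<lambda>(z', w). z' = z \<longrightarrow> w \<in> U) uniformity)"

definition Basis_double :: "double set" where
  "Basis_double = {Double 1 0, Double 0 1}"

instance
proof
  fix z :: double
  have "(\<forall>u\<in>Basis. inner z u = 0) \<longleftrightarrow> inner z (Double 1 0) = 0 \<and> inner z (Double 0 1) = 0"
    by (simp add: Basis_double_def)
  then show "(\<forall>u\<in>Basis. inner z u = 0) \<longleftrightarrow> z = 0"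
    by (simp add: inner_double_def double_eq_iff)
qed (auto simp: inner_double_def norm_double_def sgn_double_def dist_double_def
      uniformity_double_def open_double_def Basis_double_def double_eq_iff
      algebra_simps add_nonneg_eq_0_iff)

end

definition tau :: double where
  "tau = Double 0 1"

lemma tau_times_tau: "tau * tau = 1"
  by (simp add: tau_def double_eq_iff)

lemma Double_conv_tau: "Double x y = of_real x + tau * of_real y"
  by (simp add: tau_def double_eq_iff of_real_def)

definition exp_tau :: "real \<Rightarrow> double" where
  "exp_tau \<theta> = of_real (cosh \<theta>) + tau * of_real (sinh \<theta>)"


section \<open>Linear algebra of n-dimensional double space\<close>

text \<open>\<open>double ^ 'n\<close> is the \<open>n\<close>-dimensional double space, \<open>n = CARD('n)\<close>.\<close>

definition ip :: "double ^ 'n \<Rightarrow> double ^ 'n \<Rightarrow> real" where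
  "ip z w = (\<Sum>j\<in>UNIV. xpart (z $ j) * xpart (w $ j) - ypart (z $ j) * ypart (w $ j))"

definition omega :: "double ^ 'n \<Rightarrow> double ^ 'n \<Rightarrow> real" where
  "omega z w = (\<Sum>j\<in>UNIV. xpart (z $ j) * ypart (w $ j) - ypart (z $ j) * xpart (w $ j))"

text \<open>
  An \<open>n\<close>-tuple of vectors is an element \<open>v\<close> of \<open>(double ^ 'n) ^ 'n\<close>, the vectors being the
  \<open>v $ i\<close>. The value of \<open>dz\<^sub>1 \<and> \<dots> \<and> dz\<^sub>n\<close> on it is the determinant of the matrix with entries
  \<open>dz\<^sub>j (v $ i) = v $ i $ j\<close>. Coordinates and vectors are indexed by the same type, so that
  this does not depend on an enumeration of the index type.
\<close>

definition dz :: "(double ^ 'n) ^ 'n \<Rightarrow> double" where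
  "dz v = det v"

definition ordered_basis :: "(double ^ 'n) set \<Rightarrow> (double ^ 'n) ^ 'n \<Rightarrow> bool" where
  "ordered_basis V e \<longleftrightarrow>
     inj (($) e) \<and> independent (range (($) e)) \<and> span (range (($) e)) = V"

text \<open>The tuple \<open>e\<close> multiplied from the right by the matrix \<open>A\<close>.\<close>

definition transform :: "(double ^ 'n) ^ 'n \<Rightarrow> real ^ 'n ^ 'n \<Rightarrow> (double ^ 'n) ^ 'n" where
  "transform e A = (\<chi> j. \<Sum>i\<in>UNIV. (A $ i $ j) *\<^sub>R (e $ i))"

definition orthonormal :: "(double ^ 'n) ^ 'n \<Rightarrow> bool" where
  "orthonormal e \<longleftrightarrow>
     (\<forall>i. ip (e $ i) (e $ i) = 1 \<or> ip (e $ i) (e $ i) = - 1) \<and>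
     (\<forall>i j. i \<noteq> j \<longrightarrow> ip (e $ i) (e $ j) = 0)"

definition nondegenerate :: "(double ^ 'n) set \<Rightarrow> bool" where
  "nondegenerate V \<longleftrightarrow> (\<forall>v\<in>V. (\<forall>w\<in>V. ip v w = 0) \<longrightarrow> v = 0)"

definition has_signature :: "(double ^ 'n) set \<Rightarrow> nat \<Rightarrow> nat \<Rightarrow> bool" where
  "has_signature V p q \<longleftrightarrow>
     (\<exists>e. ordered_basis V e \<and> orthonormal e \<and>
        card {i. ip (e $ i) (e $ i) = 1} = p \<and> card {i. ip (e $ i) (e $ i) = - 1} = q)"

text \<open>
  The component of \<open>z\<close> normal to \<open>V\<close>; it is uniquely determined if \<open>V\<close> is a non-degenerate
  subspace.
\<close>

definition normal_part :: "(double ^ 'n) set \<Rightarrow> double ^ 'n \<Rightarrow> double ^ 'n" where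
  "normal_part V z = (THE m. (\<forall>t\<in>V. ip m t = 0) \<and> z - m \<in> V)"


section \<open>Submanifolds\<close>

text \<open>
  \<open>Ck_on k S f\<close> means that \<open>f\<close> is \<open>k\<close> times continuously differentiable on the open set \<open>S\<close>.
\<close>

primrec Ck_on ::
  "nat \<Rightarrow> 'a::euclidean_space set \<Rightarrow> ('a \<Rightarrow> 'b::euclidean_space) \<Rightarrow> bool" where
  "Ck_on 0 S f \<longleftrightarrow> continuous_on S f"
| "Ck_on (Suc k) S f \<longleftrightarrow>
     (\<forall>x\<in>S. f differentiable (at x)) \<and>
     (\<forall>v. Ck_on k S (\<lambda>x. frechet_derivative f (at x) v))"

definition smooth_on :: "'a::euclidean_space set \<Rightarrow> ('a \<Rightarrow> 'b::euclidean_space) \<Rightarrow> bool" where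
  "smooth_on S f \<longleftrightarrow> (\<forall>k. Ck_on k S f)"

definition local_param ::
  "(double ^ 'n) set \<Rightarrow> (real ^ 'n) set \<Rightarrow> (real ^ 'n \<Rightarrow> double ^ 'n) \<Rightarrow> bool" where
  "local_param M U f \<longleftrightarrow>
     open U \<and> smooth_on U f \<and> (\<forall>u\<in>U. inj (frechet_derivative f (at u))) \<and>
     openin (top_of_set M) (f ` U) \<and> (\<exists>g. homeomorphism U (f ` U) f g)"

text \<open>Smooth embedded submanifolds of half the real dimension of the ambient space.\<close>

definition submanifold :: "(double ^ 'n) set \<Rightarrow> bool" where
  "submanifold M \<longleftrightarrow> (\<forall>x\<in>M. \<exists>U f. local_param M U f \<and> x \<in> f ` U)"

definition tangent_space :: "(double ^ 'n) set \<Rightarrow> double ^ 'n \<Rightarrow> (double ^ 'n) set" where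
  "tangent_space M x =
     {frechet_derivative f (at u) a | U f u a. local_param M U f \<and> u \<in> U \<and> f u = x}"

definition smooth_function :: "(double ^ 'n) set \<Rightarrow> (double ^ 'n \<Rightarrow> real) \<Rightarrow> bool" where
  "smooth_function M h \<longleftrightarrow> (\<forall>U f. local_param M U f \<longrightarrow> smooth_on U (h \<circ> f))"

definition coordinate_frame ::
  "(real ^ 'n \<Rightarrow> double ^ 'n) \<Rightarrow> real ^ 'n \<Rightarrow> (double ^ 'n) ^ 'n" where
  "coordinate_frame f u = (\<chi> i. frechet_derivative f (at u) (axis i 1))"

text \<open>
  An orientation assigns to each point \<open>x\<close> one of the two classes of ordered bases of the
  tangent space at \<open>x\<close> (the positively oriented ones), consistently with local
  parametrizations.
\<close>

definition orientation ::
  "(double ^ 'n) set \<Rightarrow> (double ^ 'n \<Rightarrow> ((double ^ 'n) ^ 'n) set) \<Rightarrow> bool" where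
  "orientation M Or \<longleftrightarrow>
     (\<forall>x\<in>M. \<exists>e. ordered_basis (tangent_space M x) e \<and> Or x = {transform e A | A. det A > 0}) \<and>
     (\<forall>x\<in>M. \<exists>U f. local_param M U f \<and> x \<in> f ` U \<and>
        (\<forall>u\<in>U. coordinate_frame f u \<in> Or (f u)))"

definition lagrangian :: "(double ^ 'n) set \<Rightarrow> bool" where
  "lagrangian M \<longleftrightarrow> (\<forall>x\<in>M. \<forall>v\<in>tangent_space M x. \<forall>w\<in>tangent_space M x. omega v w = 0)"

definition nondegenerate_submanifold :: "(double ^ 'n) set \<Rightarrow> bool" where
  "nondegenerate_submanifold M \<longleftrightarrow> (\<forall>x\<in>M. nondegenerate (tangent_space M x))"


section \<open>Volume form and phase\<close>

text \<open>
  The \<open>n\<close>-form on the tangent space at \<open>x\<close> that has value \<open>1\<close> on oriented orthonormal bases: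
  its value on a tuple of tangent vectors is the determinant of their coefficients with
  respect to any such basis.
\<close>

definition vol_form ::
  "(double ^ 'n \<Rightarrow> ((double ^ 'n) ^ 'n) set) \<Rightarrow> double ^ 'n \<Rightarrow> (double ^ 'n) ^ 'n \<Rightarrow> real" where
  "vol_form Or x v = (THE c. \<exists>e A. e \<in> Or x \<and> orthonormal e \<and> v = transform e A \<and> c = det A)"

definition phase_function ::
  "(double ^ 'n) set \<Rightarrow> (double ^ 'n \<Rightarrow> ((double ^ 'n) ^ 'n) set) \<Rightarrow>
     (double ^ 'n \<Rightarrow> real) \<Rightarrow> bool" where
  "phase_function M Or \<theta> \<longleftrightarrow>
     smooth_function M \<theta> \<and>
     (\<exists>p q. (\<forall>x\<in>M. has_signature (tangent_space M x) p q) \<and>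
        (\<exists>s::double. (s = 1 \<or> s = - 1) \<and>
           (\<forall>x\<in>M. \<forall>v. (\<forall>i. v $ i \<in> tangent_space M x) \<longrightarrow>
              s * tau ^ q * dz v = exp_tau (\<theta> x) * of_real (vol_form Or x v))))"

definition constant_phase ::
  "(double ^ 'n) set \<Rightarrow> (double ^ 'n \<Rightarrow> ((double ^ 'n) ^ 'n) set) \<Rightarrow> bool" where
  "constant_phase M Or \<longleftrightarrow> (\<exists>\<theta>. phase_function M Or \<theta> \<and> (\<exists>c. \<forall>x\<in>M. \<theta> x = c))"


section \<open>Mean curvature\<close>

text \<open>
  The second fundamental form at \<open>x\<close> is \<open>II(v, w) = (\<nabla>\<^sub>v W)\<^sup>\<bottom>\<close>, where \<open>W\<close> is any tangent vector
  field of \<open>M\<close> near \<open>x\<close> with \<open>W x = w\<close> and \<open>\<nabla>\<close> is the flat connection of the ambient space.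
  As \<open>W\<close> is only defined along \<open>M\<close>, it is differentiated via a local parametrization \<open>f\<close>:
  \<open>\<nabla>\<^sub>v W\<close> is the derivative of \<open>W \<circ> f\<close> at \<open>u\<close> in the direction \<open>a\<close> that \<open>f\<close> maps to \<open>v\<close>.
\<close>

definition second_fundamental_form ::
  "(double ^ 'n) set \<Rightarrow> double ^ 'n \<Rightarrow> double ^ 'n \<Rightarrow> double ^ 'n \<Rightarrow> double ^ 'n" where
  "second_fundamental_form M x v w =
     (THE h. \<exists>U f W u a.
        local_param M U f \<and>
        smooth_on U (W \<circ> f) \<and> (\<forall>y\<in>f ` U. W y \<in> tangent_space M y) \<and> W x = w \<and>
        u \<in> U \<and> f u = x \<and> frechet_derivative f (at u) a = v \<and>
        h = normal_part (tangent_space M x) (frechet_derivative (W \<circ> f) (at u) a))"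

text \<open>
  The trace with respect to the induced metric, computed in an arbitrary orthonormal basis of
  the tangent space.
\<close>

definition mean_curvature :: "(double ^ 'n) set \<Rightarrow> double ^ 'n \<Rightarrow> double ^ 'n" where
  "mean_curvature M x =
     (THE h. \<exists>e. ordered_basis (tangent_space M x) e \<and> orthonormal e \<and>
        h = (\<Sum>i\<in>UNIV. ip (e $ i) (e $ i) *\<^sub>R second_fundamental_form M x (e $ i) (e $ i)))"

definition minimal :: "(double ^ 'n) set \<Rightarrow> bool" where
  "minimal M \<longleftrightarrow> (\<forall>x\<in>M. mean_curvature M x = 0)"

end

theory Submission
  imports Defs
begin

text \<open>
  Let \<open>F\<close> be the coordinate frame of a local parametrization \<open>f\<close>. A tangent space \<open>T\<close> and \<open>\<tau> T\<close> are
  complementary, so the derivative of \<open>F\<close> in direction \<open>a\<close> is \<open>(A + \<tau> B) F\<close> with real matrices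
  \<open>A\<close>, \<open>B\<close>, and \<open>dz F\<close> has the logarithmic derivative \<open>tr A + \<tau> tr B\<close>. The cubic form
  \<open>\<omega>(\<partial>\<^sub>a \<partial>\<^sub>b f, \<partial>\<^sub>c f)\<close> is totally symmetric (by symmetry of second derivatives and by
  differentiating \<open>\<omega> = 0\<close>), which yields \<open>tr B = - \<langle>H, \<tau> \<partial>\<^sub>a f\<rangle>\<close> for the mean curvature vector \<open>H\<close>.
  As \<open>tr B\<close> is the derivative of the phase and \<open>H\<close> lies in \<open>\<tau> T\<close>, the phase is locally constant if
  and only if \<open>H = 0\<close>. Determinants over the double numbers are handled via the ring homomorphisms
  \<open>x + \<tau> y \<mapsto> x \<plusminus> y\<close>, which turn them into pairs of real determinants.
\<close>

text \<open>In both directions the phase is read off a ratio: with \<open>P\<close> and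
  \<open>Q\<close> the two null components of \<open>dz F\<close>, a phase satisfies
  \<open>P / Q = (-1)^q exp (2 \<theta>)\<close>, since volume form and sign cancel. Its logarithmic
  derivative is \<open>2 tr B\<close>; \<open>tr A\<close> drops out. The converse meets a further
  obstacle: \<open>phase_function\<close> demands one signature and one sign on all of
  \<open>M\<close>, while orthonormal frames are only chosen point by point. The product of the null
  components of \<open>dz e\<close> is the Gram determinant of \<open>e\<close>, so signature and
  ratio determine \<open>dz e\<close> up to sign, and continuity of \<open>dz F\<close> fixes the
  sign. The signature is locally constant by a perturbed form of Sylvester's law, and connectedness
  makes all these data global. The notions defined by \<open>THE\<close> must moreover be shown to
  be well defined. For the mean curvature no invariance of traces is computed: in every orthonormal
  frame the trace is determined by the derivative of the same function \<open>dz F\<close>.\<close>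

subsection \<open>Calculus preliminaries\<close>

lemma mixed_difference_mean_value:
  fixes g :: "'a::real_normed_vector \<Rightarrow> real"
  assumes h: "h > 0"
    and U: "\<And>s t. 0 \<le> s \<Longrightarrow> s \<le> h \<Longrightarrow> 0 \<le> t \<Longrightarrow> t \<le> h \<Longrightarrow> u + s *\<^sub>R a + t *\<^sub>R b \<in> U"
    and g': "\<And>x. x \<in> U \<Longrightarrow> (g has_derivative g' x) (at x)"
    and g'': "\<And>x. x \<in> U \<Longrightarrow> ((\<lambda>x. g' x a) has_derivative g'' x) (at x)"
  shows "\<exists>s t. 0 < s \<and> s < h \<and> 0 < t \<and> t < h \<and>
    g (u + h *\<^sub>R a + h *\<^sub>R b) - g (u + h *\<^sub>R a) - g (u + h *\<^sub>R b) + g u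
      = h * (h * g'' (u + s *\<^sub>R a + t *\<^sub>R b) b)"
proof -
  \<comment> \<open>The mean value theorem is applied to this increment as a function of the step
    along \<open>a\<close>, then to \<open>g' _ a\<close> along \<open>b\<close>. Hence only the
    directional derivative \<open>g' _ a\<close> has to be differentiable, which is what
    \<open>Ck_on\<close> supplies.\<close>
  let ?\<psi> = "\<lambda>s. g (u + s *\<^sub>R a + h *\<^sub>R b) - g (u + s *\<^sub>R a)"
  have d1: "((\<lambda>s. g (u + s *\<^sub>R a + t *\<^sub>R b)) has_real_derivative g' (u + s *\<^sub>R a + t *\<^sub>R b) a) (at s)"
    if "0 \<le> s" "s \<le> h" "0 \<le> t" "t \<le> h" for s t
  proof -
    have x: "u + s *\<^sub>R a + t *\<^sub>R b \<in> U" using U that by blast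
    have lin: "linear (g' (u + s *\<^sub>R a + t *\<^sub>R b))"
      using g'[OF x] has_derivative_linear by blast
    have "((\<lambda>s. g (u + s *\<^sub>R a + t *\<^sub>R b)) has_derivative
        (\<lambda>k. g' (u + s *\<^sub>R a + t *\<^sub>R b) (k *\<^sub>R a))) (at s)"
      by (rule has_derivative_compose[where f="\<lambda>s. u + s *\<^sub>R a + t *\<^sub>R b", OF _ g'[OF x]])
        (auto intro!: derivative_eq_intros)
    then show ?thesis
      by (rule has_derivative_imp_has_field_derivative) (simp add: linear_cmul[OF lin])
  qed
  have d2: "((\<lambda>t. g' (u + s *\<^sub>R a + t *\<^sub>R b) a) has_real_derivative g'' (u + s *\<^sub>R a + t *\<^sub>R b) b) (at t)"
    if "0 \<le> s" "s \<le> h" "0 \<le> t" "t \<le> h" for s t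
  proof -
    have x: "u + s *\<^sub>R a + t *\<^sub>R b \<in> U" using U that by blast
    have lin: "linear (g'' (u + s *\<^sub>R a + t *\<^sub>R b))"
      using g''[OF x] has_derivative_linear by blast
    have "((\<lambda>t. g' (u + s *\<^sub>R a + t *\<^sub>R b) a) has_derivative
        (\<lambda>k. g'' (u + s *\<^sub>R a + t *\<^sub>R b) (k *\<^sub>R b))) (at t)"
      by (rule has_derivative_compose[where f="\<lambda>t. u + s *\<^sub>R a + t *\<^sub>R b", OF _ g''[OF x]])
        (auto intro!: derivative_eq_intros)
    then show ?thesis
      by (rule has_derivative_imp_has_field_derivative) (simp add: linear_cmul[OF lin])
  qed
  have "\<exists>s. 0 < s \<and> s < h \<and> ?\<psi> h - ?\<psi> 0 =
      (h - 0) * (g' (u + s *\<^sub>R a + h *\<^sub>R b) a - g' (u + s *\<^sub>R a) a)"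
  proof (rule MVT2[OF h])
    fix s assume s: "0 \<le> s" "s \<le> h"
    show "(?\<psi> has_real_derivative (g' (u + s *\<^sub>R a + h *\<^sub>R b) a - g' (u + s *\<^sub>R a) a)) (at s)"
      using DERIV_diff[OF d1[OF s, of h] d1[OF s, of 0]] h by simp
  qed
  then obtain s where s: "0 < s" "s < h"
    and 1: "?\<psi> h - ?\<psi> 0 = h * (g' (u + s *\<^sub>R a + h *\<^sub>R b) a - g' (u + s *\<^sub>R a) a)"
    by auto
  have "\<exists>t. 0 < t \<and> t < h \<and> g' (u + s *\<^sub>R a + h *\<^sub>R b) a - g' (u + s *\<^sub>R a + 0 *\<^sub>R b) a =
      (h - 0) * g'' (u + s *\<^sub>R a + t *\<^sub>R b) b"
    by (rule MVT2[OF h]) (use s in \<open>auto intro!: d2\<close>)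
  then obtain t where t: "0 < t" "t < h"
    and 2: "g' (u + s *\<^sub>R a + h *\<^sub>R b) a - g' (u + s *\<^sub>R a) a = h * g'' (u + s *\<^sub>R a + t *\<^sub>R b) b"
    by auto
  show ?thesis
    using s t 1 unfolding 2 by (intro exI[of _ s] exI[of _ t]) simp
qed

text \<open>The mixed second difference does not change when \<open>a\<close> and \<open>b\<close>
  are exchanged, and in either order it is \<open>h * h\<close> times a second derivative at some
  point close to \<open>u\<close>. Continuity then identifies the two values at
  \<open>u\<close>.\<close>

lemma symmetric_second_derivative:
  fixes g :: "'a::real_normed_vector \<Rightarrow> real"
  assumes "open U" "u \<in> U"
    and g': "\<And>x. x \<in> U \<Longrightarrow> (g has_derivative g' x) (at x)"
    and ga: "\<And>x. x \<in> U \<Longrightarrow> ((\<lambda>x. g' x a) has_derivative ga x) (at x)"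
    and gb: "\<And>x. x \<in> U \<Longrightarrow> ((\<lambda>x. g' x b) has_derivative gb x) (at x)"
    and ca: "continuous_on U (\<lambda>x. ga x b)" and cb: "continuous_on U (\<lambda>x. gb x a)"
  shows "ga u b = gb u a"
proof (rule ccontr)
  assume "ga u b \<noteq> gb u a"
  \<comment> \<open>Half the gap: the two second derivatives agree at their intermediate points, and
    each is within \<open>e\<close> of its value at \<open>u\<close>.\<close>
  define e where "e = \<bar>ga u b - gb u a\<bar> / 2"
  have e: "e > 0" using \<open>ga u b \<noteq> gb u a\<close> by (simp add: e_def)
  have "isCont (\<lambda>x. ga x b) u" "isCont (\<lambda>x. gb x a) u"
    using ca cb assms(1,2) continuous_on_eq_continuous_at by blast+
  then have "((\<lambda>x. ga x b) \<longlongrightarrow> ga u b) (nhds u)" "((\<lambda>x. gb x a) \<longlongrightarrow> gb u a) (nhds u)"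
    using tendsto_at_iff_tendsto_nhds[of "\<lambda>x. ga x b" u]
      tendsto_at_iff_tendsto_nhds[of "\<lambda>x. gb x a" u] unfolding isCont_def by blast+
  then have "\<forall>\<^sub>F x in nhds u. dist (ga x b) (ga u b) < e \<and> dist (gb x a) (gb u a) < e \<and> x \<in> U"
    using e assms(1,2)
    by (intro eventually_conj tendstoD eventually_nhds_in_open)
  then obtain d where d: "d > 0"
    and D: "\<And>x. dist x u < d \<Longrightarrow> dist (ga x b) (ga u b) < e \<and> dist (gb x a) (gb u a) < e \<and> x \<in> U"
    unfolding eventually_nhds_metric by blast
  \<comment> \<open>Small enough to keep the whole parallelogram within \<open>d / 2\<close> of
    \<open>u\<close>. The summand 1 prevents division by zero when \<open>a\<close> and
    \<open>b\<close> vanish.\<close>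
  define h where "h = d / (2 * (norm a + norm b + 1))"
  have pos: "norm a + norm b + 1 > 0" by (simp add: add_nonneg_pos)
  have h: "h > 0" using d pos by (simp add: h_def)
  have near: "dist (u + s *\<^sub>R x + t *\<^sub>R y) u < d"
    if "0 \<le> s" "s \<le> h" "0 \<le> t" "t \<le> h" "norm x + norm y \<le> norm a + norm b" for s t x y
  proof -
    have "dist (u + s *\<^sub>R x + t *\<^sub>R y) u = norm (s *\<^sub>R x + t *\<^sub>R y)"
      by (simp add: dist_norm add.assoc)
    also have "\<dots> \<le> s * norm x + t * norm y"
      using norm_triangle_ineq[of "s *\<^sub>R x" "t *\<^sub>R y"] that by simp
    also have "\<dots> \<le> h * norm x + h * norm y"
      using that by (intro add_mono mult_right_mono) auto
    also have "\<dots> \<le> h * (norm a + norm b + 1)"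
      using h that(5) by (simp add: distrib_left[symmetric])
    also have "\<dots> = d / 2" using pos unfolding h_def by (simp add: divide_simps)
    also have "\<dots> < d" using d by simp
    finally show ?thesis .
  qed
  have sub1: "u + s *\<^sub>R a + t *\<^sub>R b \<in> U" if "0 \<le> s" "s \<le> h" "0 \<le> t" "t \<le> h" for s t
    using D[OF near] that by auto
  have sub2: "u + s *\<^sub>R b + t *\<^sub>R a \<in> U" if "0 \<le> s" "s \<le> h" "0 \<le> t" "t \<le> h" for s t
    using D[OF near] that by auto
  from mixed_difference_mean_value[of h u a b U g g' ga, OF h sub1 g' ga]
  obtain s t where st: "0 < s" "s < h" "0 < t" "t < h"
    and 1: "g (u + h *\<^sub>R a + h *\<^sub>R b) - g (u + h *\<^sub>R a) - g (u + h *\<^sub>R b) + g u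
      = h * (h * ga (u + s *\<^sub>R a + t *\<^sub>R b) b)" by blast
  from mixed_difference_mean_value[of h u b a U g g' gb, OF h sub2 g' gb]
  obtain s' t' where st': "0 < s'" "s' < h" "0 < t'" "t' < h"
    and 2: "g (u + h *\<^sub>R b + h *\<^sub>R a) - g (u + h *\<^sub>R b) - g (u + h *\<^sub>R a) + g u
      = h * (h * gb (u + s' *\<^sub>R b + t' *\<^sub>R a) a)" by blast
  have swap: "u + h *\<^sub>R b + h *\<^sub>R a = u + h *\<^sub>R a + h *\<^sub>R b" by simp
  then have "h * (h * ga (u + s *\<^sub>R a + t *\<^sub>R b) b) = h * (h * gb (u + s' *\<^sub>R b + t' *\<^sub>R a) a)"
    using 1 2 unfolding swap by linarith
  then have eq: "ga (u + s *\<^sub>R a + t *\<^sub>R b) b = gb (u + s' *\<^sub>R b + t' *\<^sub>R a) a"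
    using h by simp
  have "dist (ga (u + s *\<^sub>R a + t *\<^sub>R b) b) (ga u b) < e"
    using D[OF near[of s t a b]] st by simp
  moreover have "dist (gb (u + s' *\<^sub>R b + t' *\<^sub>R a) a) (gb u a) < e"
    using D[OF near[of s' t' b a]] st' by simp
  ultimately show False
    unfolding eq by (auto simp: e_def dist_real_def abs_if split: if_splits)
qed

section \<open>Derivatives of determinants\<close>

lemma has_derivative_det:
  fixes F :: "'a::real_normed_vector \<Rightarrow> real ^ 'n ^ 'n"
  assumes F: "\<And>i j. ((\<lambda>y. F y $ i $ j) has_derivative F' i j) (at x)"
  shows "((\<lambda>y. det (F y)) has_derivative
    (\<lambda>h. \<Sum>i\<in>UNIV. det (\<chi> k. if k = i then (\<chi> j. F' i j h) else F x $ k))) (at x)"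
proof -
  have "((\<lambda>y. det (F y)) has_derivative
    (\<lambda>h. \<Sum>p | p permutes UNIV. of_int (sign p) *
      (\<Sum>i\<in>UNIV. F' i (p i) h * (\<Prod>k\<in>UNIV - {i}. F x $ k $ p k)))) (at x)"
    unfolding det_def by (intro derivative_intros F)
  moreover have "(\<Sum>p | p permutes UNIV. of_int (sign p) *
      (\<Sum>i\<in>UNIV. F' i (p i) h * (\<Prod>k\<in>UNIV - {i}. F x $ k $ p k)))
    = (\<Sum>i\<in>UNIV. det (\<chi> k. if k = i then (\<chi> j. F' i j h) else F x $ k))" for h
  proof -
    have "(\<Prod>k\<in>UNIV. (\<chi> k. if k = i then (\<chi> j. F' i j h) else F x $ k) $ k $ p k)
      = F' i (p i) h * (\<Prod>k\<in>UNIV - {i}. F x $ k $ p k)" for i p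
      by (subst prod.remove[of _ i]) auto
    then show ?thesis
      unfolding det_def sum_distrib_left by (subst sum.swap) simp
  qed
  ultimately show ?thesis by simp
qed

text \<open>By multilinearity every term with \<open>l \<noteq> i\<close> repeats a row and
  vanishes. This is why only the diagonal of the coefficient matrix survives and a trace
  appears.\<close>

lemma det_replace_row_by_combination:
  fixes A :: "real ^ 'n ^ 'n"
  shows "det (\<chi> k. if k = i then (\<Sum>l\<in>UNIV. c l *\<^sub>R A $ l) else A $ k) = c i * det A"
proof -
  have "(\<chi> k. if k = i then (\<Sum>l\<in>UNIV. c l *\<^sub>R A $ l) else A $ k)
    = (\<chi> k. if k = i then sum (\<lambda>l. (\<chi> l. c l) $ l *s row l A) UNIV else row k A)"
    by (simp add: vec_eq_iff row_def)
  then show ?thesis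
    by (simp only: cramer_lemma_transpose) simp
qed

text \<open>A continuous lift of a differentiable map through an immersion is differentiable. A
  linear left inverse \<open>L\<close> of \<open>f'\<close> recovers the increments of
  \<open>\<beta>\<close> from those of \<open>\<gamma>\<close>, up to the linearization errors. This
  is what makes transition maps differentiable, which are at first only known to be
  continuous.\<close>

lemma has_derivative_lift_immersion:
  fixes f :: "'a::euclidean_space \<Rightarrow> 'b::euclidean_space"
    and \<beta> :: "'c::real_normed_vector \<Rightarrow> 'a"
  assumes f: "(f has_derivative f') (at (\<beta> s))" and inj: "inj f'"
    and \<gamma>: "(\<gamma> has_derivative \<gamma>') (at s)"
    and \<beta>: "isCont \<beta> s"
    and eq: "\<forall>\<^sub>F t in nhds s. f (\<beta> t) = \<gamma> t"
  shows "\<exists>\<beta>'. (\<beta> has_derivative \<beta>') (at s) \<and> (\<forall>h. f' (\<beta>' h) = \<gamma>' h)"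
proof -
  have linf: "linear f'" using f has_derivative_linear by blast
  obtain L where L: "linear L" "L \<circ> f' = id"
    using linear_injective_left_inverse[OF linf inj] by blast
  have Lf: "L (f' x) = x" for x using L(2) by (metis comp_apply id_apply)
  have bL: "bounded_linear L" using L(1) linear_conv_bounded_linear by blast
  obtain K where K: "K > 0" "\<And>x. norm (L x) \<le> norm x * K"
    using bounded_linear.pos_bounded[OF bL] by blast
  have b\<gamma>: "bounded_linear \<gamma>'" using \<gamma> has_derivative_bounded_linear by blast
  obtain N where N: "N > 0" "\<And>x. norm (\<gamma>' x) \<le> norm x * N"
    using bounded_linear.pos_bounded[OF b\<gamma>] by blast
  have fs: "f (\<beta> s) = \<gamma> s" using eventually_nhds_x_imp_x[OF eq] .
  have fe: "\<forall>\<^sub>F t in nhds s. norm (f (\<beta> t) - f (\<beta> s) - f' (\<beta> t - \<beta> s)) \<le> e * norm (\<beta> t - \<beta> s)"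
    if e: "e > 0" for e
  proof -
    from f e obtain d where d: "d > 0" "\<And>y. norm (y - \<beta> s) < d \<Longrightarrow>
        norm (f y - f (\<beta> s) - f' (y - \<beta> s)) \<le> e * norm (y - \<beta> s)"
      unfolding has_derivative_at_alt by blast
    have "\<forall>\<^sub>F t in nhds s. dist (\<beta> t) (\<beta> s) < d"
      using \<beta> d(1) unfolding isCont_def tendsto_at_iff_tendsto_nhds by (intro tendstoD)
    then show ?thesis
      by eventually_elim (use d(2) in \<open>auto simp: dist_norm\<close>)
  qed
  have ge: "\<forall>\<^sub>F t in nhds s. norm (\<gamma> t - \<gamma> s - \<gamma>' (t - s)) \<le> e * norm (t - s)"
    if e: "e > 0" for e
  proof -
    from \<gamma> e obtain d where d: "d > 0" "\<And>y. norm (y - s) < d \<Longrightarrow>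
        norm (\<gamma> y - \<gamma> s - \<gamma>' (y - s)) \<le> e * norm (y - s)"
      unfolding has_derivative_at_alt by blast
    then show ?thesis
      unfolding eventually_nhds_metric dist_norm by blast
  qed
  have key: "norm (\<beta> t - \<beta> s - L (\<gamma>' (t - s))) \<le> K * norm (\<gamma> t - \<gamma> s - \<gamma>' (t - s))
      + K * norm (f (\<beta> t) - f (\<beta> s) - f' (\<beta> t - \<beta> s))" if "f (\<beta> t) = \<gamma> t" for t
  proof -
    have "\<beta> t - \<beta> s - L (\<gamma>' (t - s)) = L (\<gamma> t - \<gamma> s - \<gamma>' (t - s))
      - L (f (\<beta> t) - f (\<beta> s) - f' (\<beta> t - \<beta> s))"
      using that fs by (simp add: linear_diff[OF L(1)] Lf)
    then have "norm (\<beta> t - \<beta> s - L (\<gamma>' (t - s))) \<le> norm (L (\<gamma> t - \<gamma> s - \<gamma>' (t - s)))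
      + norm (L (f (\<beta> t) - f (\<beta> s) - f' (\<beta> t - \<beta> s)))"
      by (simp only: norm_triangle_ineq4)
    then show ?thesis
      using K(2)[of "\<gamma> t - \<gamma> s - \<gamma>' (t - s)"] K(2)[of "f (\<beta> t) - f (\<beta> s) - f' (\<beta> t - \<beta> s)"]
      by (simp add: mult.commute)
  qed
  \<comment> \<open>The constant of \<open>Lip\<close>: with tolerance \<open>1 / (2 * K)\<close> in
    \<open>fe\<close>, the estimate \<open>key\<close> bounds the increment of
    \<open>\<beta>\<close> by half its own size, which is absorbed on the left, plus
    \<open>K * (1 + N) * norm (t - s)\<close>.\<close>
  define C where "C = 2 * K * (1 + N)"
  have C: "C > 0" using K N by (simp add: C_def)
  have Lip: "\<forall>\<^sub>F t in nhds s. norm (\<beta> t - \<beta> s) \<le> C * norm (t - s)"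
  proof -
    have k2: "1 / (2 * K) > 0" using K by simp
    show ?thesis
      using eq fe[OF k2] ge[OF zero_less_one]
    proof eventually_elim
      case (elim t)
      have "K * norm (f (\<beta> t) - f (\<beta> s) - f' (\<beta> t - \<beta> s)) \<le> K * (1 / (2 * K) * norm (\<beta> t - \<beta> s))"
        using elim(2) K(1) by (intro mult_left_mono) auto
      also have "\<dots> = norm (\<beta> t - \<beta> s) / 2" using K(1) by simp
      finally have 1: "K * norm (f (\<beta> t) - f (\<beta> s) - f' (\<beta> t - \<beta> s)) \<le> norm (\<beta> t - \<beta> s) / 2" .
      have 2: "K * norm (\<gamma> t - \<gamma> s - \<gamma>' (t - s)) \<le> K * norm (t - s)"
        using elim(3) K(1) by (intro mult_left_mono) auto
      have "norm (L (\<gamma>' (t - s))) \<le> norm (\<gamma>' (t - s)) * K" by (rule K(2))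
      also have "\<dots> \<le> norm (t - s) * N * K" using N(2) K(1) by (intro mult_right_mono) auto
      finally have 3: "norm (L (\<gamma>' (t - s))) \<le> norm (t - s) * N * K" .
      have "norm (\<beta> t - \<beta> s) \<le> norm (\<beta> t - \<beta> s - L (\<gamma>' (t - s))) + norm (L (\<gamma>' (t - s)))"
        by (metis diff_add_cancel norm_triangle_ineq)
      then have "norm (\<beta> t - \<beta> s) \<le> 2 * (K * norm (t - s) + norm (t - s) * N * K)"
        using key[OF elim(1)] 1 2 3 by argo
      then show ?case by (simp add: C_def algebra_simps)
    qed
  qed
  have "(\<beta> has_derivative (\<lambda>h. L (\<gamma>' h))) (at s)"
    unfolding has_derivative_at_alt
  proof (intro conjI allI impI)
    show "bounded_linear (\<lambda>h. L (\<gamma>' h))" using bounded_linear_compose[OF bL b\<gamma>] .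
    fix e :: real assume e: "e > 0"
    \<comment> \<open>With these tolerances each summand of \<open>key\<close> is at most
      \<open>e / 2 * norm (t - s)\<close>, the second one by way of \<open>Lip\<close>.\<close>
    have e1: "e / (2 * K) > 0" "e / (2 * K * C) > 0" using e K C by simp_all
    have "\<forall>\<^sub>F t in nhds s. norm (\<beta> t - \<beta> s - L (\<gamma>' (t - s))) \<le> e * norm (t - s)"
      using eq ge[OF e1(1)] fe[OF e1(2)] Lip
    proof eventually_elim
      case (elim t)
      have "K * norm (\<gamma> t - \<gamma> s - \<gamma>' (t - s)) \<le> K * (e / (2 * K) * norm (t - s))"
        using elim(2) K(1) by (intro mult_left_mono) auto
      also have "\<dots> = e / 2 * norm (t - s)" using K(1) by simp
      finally have 1: "K * norm (\<gamma> t - \<gamma> s - \<gamma>' (t - s)) \<le> e / 2 * norm (t - s)" .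
      have "K * norm (f (\<beta> t) - f (\<beta> s) - f' (\<beta> t - \<beta> s)) \<le> K * (e / (2 * K * C) * norm (\<beta> t - \<beta> s))"
        using elim(3) K(1) by (intro mult_left_mono) auto
      also have "\<dots> \<le> K * (e / (2 * K * C) * (C * norm (t - s)))"
        using elim(4) K(1) e1(2) by (intro mult_left_mono) auto
      also have "\<dots> = e / 2 * norm (t - s)" using K(1) C by simp
      finally show ?case using key[OF elim(1)] 1 by (simp add: field_simps)
    qed
    then show "\<exists>d>0. \<forall>y. norm (y - s) < d \<longrightarrow>
        norm (\<beta> y - \<beta> s - L (\<gamma>' (y - s))) \<le> e * norm (y - s)"
      unfolding eventually_nhds_metric dist_norm by blast
  qed
  \<comment> \<open>\<open>L\<close> inverts \<open>f'\<close> only on its range. That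
    \<open>\<gamma>'\<close> takes values there follows from differentiating
    \<open>f (\<beta> t) = \<gamma> t\<close> and the uniqueness of derivatives.\<close>
  moreover have "f' (L (\<gamma>' h)) = \<gamma>' h" for h
  proof -
    have "((\<lambda>t. f (\<beta> t)) has_derivative (\<lambda>h. f' (L (\<gamma>' h)))) (at s)"
      by (rule has_derivative_compose[OF calculation f])
    then have "(\<gamma> has_derivative (\<lambda>h. f' (L (\<gamma>' h)))) (at s)"
      by (rule has_derivative_transform_eventually)
        (use eq fs in \<open>auto simp: eventually_at_filter elim: eventually_mono\<close>)
    then show ?thesis using \<gamma> has_derivative_unique by metis
  qed
  ultimately show ?thesis by blast
qed

subsection \<open>Null coordinates on the double numbers\<close>

definition pl :: "double \<Rightarrow> real" where "pl z = xpart z + ypart z"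
definition mi :: "double \<Rightarrow> real" where "mi z = xpart z - ypart z"

lemma pl_simps [simp]:
  "pl 0 = 0" "pl 1 = 1" "pl (z + w) = pl z + pl w" "pl (- z) = - pl z" "pl (z - w) = pl z - pl w"
  "pl (z * w) = pl z * pl w" "pl (r *\<^sub>R z) = r * pl z" "pl tau = 1" "pl (of_real r) = r"
  by (simp_all add: pl_def tau_def of_real_def algebra_simps)

lemma mi_simps [simp]:
  "mi 0 = 0" "mi 1 = 1" "mi (z + w) = mi z + mi w" "mi (- z) = - mi z" "mi (z - w) = mi z - mi w"
  "mi (z * w) = mi z * mi w" "mi (r *\<^sub>R z) = r * mi z" "mi tau = - 1" "mi (of_real r) = r"
  by (simp_all add: mi_def tau_def of_real_def algebra_simps)

lemma pl_power [simp]: "pl (z ^ k) = pl z ^ k" and mi_power [simp]: "mi (z ^ k) = mi z ^ k"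
  by (induction k) simp_all

lemma pl_sum [simp]: "pl (sum h S) = (\<Sum>i\<in>S. pl (h i))"
  and mi_sum [simp]: "mi (sum h S) = (\<Sum>i\<in>S. mi (h i))"
  by (induction S rule: infinite_finite_induct) simp_all

lemma pl_prod [simp]: "pl (prod h S) = (\<Prod>i\<in>S. pl (h i))"
  and mi_prod [simp]: "mi (prod h S) = (\<Prod>i\<in>S. mi (h i))"
  by (induction S rule: infinite_finite_induct) simp_all

lemma pl_of_int [simp]: "pl (of_int k) = of_int k" and mi_of_int [simp]: "mi (of_int k) = of_int k"
  using pl_simps(9)[of "of_int k"] mi_simps(9)[of "of_int k"] by simp_all

lemma pl_exp_tau [simp]: "pl (exp_tau c) = exp c" and mi_exp_tau [simp]: "mi (exp_tau c) = exp (- c)"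
  by (simp_all add: exp_tau_def cosh_plus_sinh cosh_minus_sinh)

lemma double_eq_pl_mi_iff: "z = w \<longleftrightarrow> pl z = pl w \<and> mi z = mi w"
  by (auto simp: double_eq_iff pl_def mi_def)

lemma pl_det: "pl (det A) = det (\<chi> i j. pl (A $ i $ j))"
  and mi_det: "mi (det A) = det (\<chi> i j. mi (A $ i $ j))"
  by (simp_all add: det_def)

lemma dz_transform: "dz (transform e A) = of_real (det A) * dz e"
proof -
  have "(\<chi> i j. pl (transform e A $ i $ j)) = transpose A ** (\<chi> i j. pl (e $ i $ j))"
    "(\<chi> i j. mi (transform e A $ i $ j)) = transpose A ** (\<chi> i j. mi (e $ i $ j))"
    by (simp_all add: transform_def matrix_matrix_mult_def transpose_def vec_eq_iff)
  then show ?thesis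
    by (simp add: dz_def double_eq_pl_mi_iff pl_det mi_det det_mul det_transpose)
qed

subsection \<open>The indefinite inner product\<close>

lemma ip_commute: "ip z w = ip w z"
  by (simp add: ip_def mult.commute)

lemma omega_commute: "omega z w = - omega w z"
  by (simp add: omega_def mult.commute sum_negf[symmetric])

lemma ip_add_left: "ip (z + z') w = ip z w + ip z' w"
  and ip_scale_left: "ip (r *\<^sub>R z) w = r * ip z w"
  by (simp_all add: ip_def sum.distrib[symmetric] sum_distrib_left algebra_simps)

lemma omega_add_left: "omega (z + z') w = omega z w + omega z' w"
  and omega_scale_left: "omega (r *\<^sub>R z) w = r * omega z w"
  by (simp_all add: omega_def sum.distrib[symmetric] sum_distrib_left algebra_simps)

lemma linear_ip_left: "linear (\<lambda>z. ip z w)" and linear_omega_left: "linear (\<lambda>z. omega z w)"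
  by (rule linearI; simp add: ip_add_left ip_scale_left omega_add_left omega_scale_left)+

lemma linear_ip_right: "linear (ip z)"
proof -
  have "ip z = (\<lambda>w. ip w z)" using ip_commute[of z] by blast
  then show ?thesis using linear_ip_left[of z] by simp
qed

lemma linear_omega_right: "linear (omega z)"
proof -
  have "omega z = (\<lambda>w. - omega w z)" using omega_commute[of z] by blast
  then show ?thesis using linear_compose_neg[OF linear_omega_left[of z]] by simp
qed

lemma bilinear_omega: "bilinear omega"
  unfolding bilinear_def using linear_omega_left linear_omega_right by blast

lemmas ip_add_right = linear_add[OF linear_ip_right]
  and ip_scale_right = linear_cmul[OF linear_ip_right]
  and ip_zero_left [simp] = linear_0[OF linear_ip_left]
  and ip_zero_right [simp] = linear_0[OF linear_ip_right]
  and ip_diff_left = linear_diff[OF linear_ip_left]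
  and ip_diff_right = linear_diff[OF linear_ip_right]
  and ip_sum_left = linear_sum[OF linear_ip_left]
  and ip_sum_right = linear_sum[OF linear_ip_right]
  and omega_sum_left = linear_sum[OF linear_omega_left]

lemma linear_tau: "linear ((*s) tau :: double ^ 'n \<Rightarrow> double ^ 'n)"
  by (rule linearI) (simp_all add: vec_eq_iff algebra_simps)

lemma tau_tau [simp]: "tau *s (tau *s z) = z"
  by (simp add: vec_eq_iff tau_times_tau mult.assoc[symmetric])

lemma ip_tau_right: "ip z (tau *s w) = omega z w"
  and ip_tau_tau: "ip (tau *s z) (tau *s w) = - ip z w"
  and omega_tau_left: "omega (tau *s z) w = - ip z w"
  by (simp_all add: ip_def omega_def tau_def sum_negf[symmetric] mult.commute)

lemma ip_tau_left: "ip (tau *s z) w = omega w z"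
  by (metis ip_commute ip_tau_right)

text \<open>
  The matrix with entries \<open>ip (e $ i) (e $ k) - \<tau> omega (e $ i) (e $ k)\<close> is the product of the
  coordinate matrix of \<open>e\<close> and its conjugate transpose.
\<close>

lemma pl_dz_mult_mi_dz:
  assumes "\<And>i k. omega (e $ i) (e $ k) = 0"
  shows "pl (dz e) * mi (dz e) = det (\<chi> i k. ip (e $ i) (e $ k))"
proof -
  have "(\<Sum>j\<in>UNIV. pl (e $ i $ j) * mi (e $ k $ j)) = ip (e $ i) (e $ k) - omega (e $ i) (e $ k)" for i k
    by (simp add: ip_def omega_def pl_def mi_def sum_subtractf[symmetric] algebra_simps)
  then have "(\<chi> i k. ip (e $ i) (e $ k))
    = (\<chi> i j. pl (e $ i $ j)) ** transpose (\<chi> i j. mi (e $ i $ j))"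
    by (simp add: vec_eq_iff matrix_matrix_mult_def transpose_def assms)
  then show ?thesis
    by (simp add: dz_def pl_det mi_det det_mul det_transpose)
qed

section \<open>Change of frame and ordered bases\<close>

lemma transform_transform: "transform (transform e A) B = transform e (A ** B)"
proof -
  have "(\<Sum>i\<in>UNIV. B $ i $ j *\<^sub>R (\<Sum>k\<in>UNIV. A $ k $ i *\<^sub>R e $ k))
      = (\<Sum>k\<in>UNIV. (\<Sum>i\<in>UNIV. A $ k $ i * B $ i $ j) *\<^sub>R e $ k)" for j
    unfolding scaleR_sum_right scaleR_sum_left by (subst sum.swap) (simp add: mult.commute)
  then show ?thesis by (simp add: transform_def matrix_matrix_mult_def vec_eq_iff)
qed

lemma gram_transform:
  "(\<chi> i k. ip (transform e A $ i) (transform e A $ k))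
    = transpose A ** (\<chi> i k. ip (e $ i) (e $ k)) ** A"
proof -
  have "ip (transform e A $ i) (transform e A $ k)
     = (\<Sum>l\<in>UNIV. (\<Sum>j\<in>UNIV. A $ j $ i * ip (e $ j) (e $ l)) * A $ l $ k)" for i k
    by (simp add: transform_def ip_sum_left ip_sum_right ip_scale_left ip_scale_right
        sum_distrib_left sum_distrib_right mult_ac)
  then show ?thesis
    by (simp add: vec_eq_iff matrix_matrix_mult_def transpose_def)
qed

lemma det_gram_orthonormal:
  assumes "orthonormal e"
  shows "det (\<chi> i k. ip (e $ i) (e $ k)) = (- 1) ^ card {i. ip (e $ i) (e $ i) = - 1}"
proof -
  have "det (\<chi> i k. ip (e $ i) (e $ k)) = (\<Prod>i\<in>UNIV. ip (e $ i) (e $ i))"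
    using assms by (subst det_diagonal) (auto simp: orthonormal_def)
  also have "\<dots> = (\<Prod>i\<in>UNIV. if ip (e $ i) (e $ i) = - 1 then - 1 else 1)"
    using assms by (intro prod.cong) (auto simp: orthonormal_def)
  also have "\<dots> = (- 1) ^ card {i. ip (e $ i) (e $ i) = - 1}"
    by (subst prod.If_cases) auto
  finally show ?thesis .
qed

lemma ordered_basis_span:
  assumes "ordered_basis V e" "v \<in> V"
  obtains c where "v = (\<Sum>i\<in>UNIV. c i *\<^sub>R e $ i)"
proof -
  have "v \<in> span (range (($) e))" using assms by (simp add: ordered_basis_def)
  then obtain r where r: "v = (\<Sum>x\<in>range (($) e). r x *\<^sub>R x)"
    unfolding span_finite[OF finite_imageI[OF finite]] by auto
  have "inj (($) e)" using assms by (simp add: ordered_basis_def)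
  then have "v = (\<Sum>i\<in>UNIV. r (e $ i) *\<^sub>R e $ i)" unfolding r by (subst sum.reindex) auto
  then show ?thesis by (rule that)
qed

lemma ordered_basis_in: "ordered_basis V e \<Longrightarrow> e $ i \<in> V"
  by (auto simp: ordered_basis_def intro: span_base)

lemma ordered_basis_subspace: "ordered_basis V e \<Longrightarrow> subspace V"
  by (auto simp: ordered_basis_def)

lemma transform_in:
  assumes "subspace V" "\<And>i. e $ i \<in> V"
  shows "transform e A $ j \<in> V"
  unfolding transform_def using assms by (auto intro!: subspace_sum subspace_scale)

lemma ordered_basis_transform_exists:
  assumes "ordered_basis V e" "\<And>i. v $ i \<in> V"
  obtains A where "v = transform e A"
proof -
  have "\<forall>j. \<exists>c. v $ j = (\<Sum>i\<in>UNIV. c i *\<^sub>R e $ i)"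
    using ordered_basis_span[OF assms(1)] assms(2) by metis
  then obtain c where "\<And>j. v $ j = (\<Sum>i\<in>UNIV. c j i *\<^sub>R e $ i)" by metis
  then have "v = transform e (\<chi> i j. c j i)" by (simp add: transform_def vec_eq_iff)
  then show ?thesis by (rule that)
qed

lemma ordered_basis_dim:
  fixes e :: "(double ^ 'n) ^ 'n"
  assumes "ordered_basis V e" shows "dim V = CARD('n)"
proof -
  have "dim V = card (range (($) e))"
    using assms dim_span_eq_card_independent[of "range (($) e)"] by (auto simp: ordered_basis_def)
  then show ?thesis using assms by (simp add: ordered_basis_def card_image)
qed

lemma ordered_basisI:
  fixes e :: "(double ^ 'n) ^ 'n"
  assumes V: "subspace V" "dim V = CARD('n)" "\<And>i. e $ i \<in> V" and sp: "V \<subseteq> span (range (($) e))"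
  shows "ordered_basis V e"
proof -
  have le: "card (range (($) e)) \<le> CARD('n)" by (rule card_image_le) simp
  have sub: "range (($) e) \<subseteq> V" using V(3) by auto
  have ind: "independent (range (($) e))"
    using card_le_dim_spanning[OF sub sp] le V(2) by simp
  have "span (range (($) e)) = V"
    using sp sub V(1) span_minimal by blast
  moreover have "card (range (($) e)) = CARD('n)"
    using ind calculation V(2) dim_span_eq_card_independent by metis
  ultimately show ?thesis using ind by (simp add: ordered_basis_def eq_card_imp_inj_on)
qed

lemma orthonormal_independent:
  assumes e: "orthonormal e" and z: "(\<Sum>i\<in>UNIV. c i *\<^sub>R e $ i) = 0"
  shows "c k = 0"
proof -
  have "0 = ip (\<Sum>i\<in>UNIV. c i *\<^sub>R e $ i) (e $ k)" by (simp add: z)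
  also have "\<dots> = (\<Sum>i\<in>UNIV. c i * ip (e $ i) (e $ k))"
    by (simp add: ip_sum_left ip_scale_left)
  also have "\<dots> = (\<Sum>i\<in>UNIV. if i = k then c k * ip (e $ k) (e $ k) else 0)"
    using e by (intro sum.cong) (auto simp: orthonormal_def)
  also have "\<dots> = c k * ip (e $ k) (e $ k)" by simp
  finally have "c k * ip (e $ k) (e $ k) = 0" by simp
  moreover have "ip (e $ k) (e $ k) = 1 \<or> ip (e $ k) (e $ k) = - 1"
    using e by (simp add: orthonormal_def)
  ultimately show ?thesis by auto
qed

subsection \<open>Orthonormal bases\<close>

text \<open>Gram-Schmidt for an indefinite form: split off a non-isotropic vector and continue in
  its orthogonal complement, which is again nondegenerate. Since \<open>B\<close> spans
  \<open>V\<close>, the bound on its cardinality stands in for linear independence.\<close>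

lemma nondegenerate_orthonormal_set:
  fixes V :: "(double ^ 'n) set"
  assumes "subspace V" "nondegenerate V"
  shows "\<exists>B. finite B \<and> B \<subseteq> V \<and> span B = V \<and> card B \<le> dim V \<and>
    (\<forall>b\<in>B. ip b b = 1 \<or> ip b b = - 1) \<and> (\<forall>b\<in>B. \<forall>b'\<in>B. b \<noteq> b' \<longrightarrow> ip b b' = 0)"
  using assms
proof (induction "dim V" arbitrary: V rule: less_induct)
  case (less V)
  show ?case
  proof (cases "V = {0}")
    case True
    then show ?thesis by (intro exI[of _ "{}"]) simp
  next
    case False
    \<comment> \<open>By polarization, a form without non-isotropic vectors vanishes on
      \<open>V\<close>, and nondegeneracy would leave only the zero space.\<close>
    have "\<exists>v\<in>V. ip v v \<noteq> 0"
    proof (rule ccontr)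
      assume "\<not> ?thesis"
      then have iso: "\<And>v. v \<in> V \<Longrightarrow> ip v v = 0" by blast
      have "ip v w = 0" if "v \<in> V" "w \<in> V" for v w
        using iso[OF subspace_add[OF less(2) that]] iso[OF that(1)] iso[OF that(2)]
        by (simp add: ip_add_left ip_add_right ip_commute[of w v])
      then have "V \<subseteq> {0}" using less(3) unfolding nondegenerate_def by blast
      then show False using False less(2) subspace_0 by blast
    qed
    then obtain v0 where v0: "v0 \<in> V" "ip v0 v0 \<noteq> 0" by blast
    define v where "v = (1 / sqrt \<bar>ip v0 v0\<bar>) *\<^sub>R v0"
    have v: "v \<in> V" using v0 less(2) by (simp add: v_def subspace_scale)
    have vv: "ip v v = 1 \<or> ip v v = - 1"
    proof -
      have "ip v v = ip v0 v0 / \<bar>ip v0 v0\<bar>"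
        by (simp add: v_def ip_scale_left ip_scale_right)
      then show ?thesis using v0(2) by (auto simp: abs_if split: if_splits)
    qed
    define W where "W = {w \<in> V. ip w v = 0}"
    have sW: "subspace W"
      unfolding W_def subspace_def using less(2)
      by (auto simp: ip_add_left ip_scale_left subspace_0 subspace_add subspace_scale)
    have dec: "\<exists>k. z - k *\<^sub>R v \<in> W" if "z \<in> V" for z
    proof (intro exI)
      show "z - (ip z v / ip v v) *\<^sub>R v \<in> W"
        using that v vv less(2) unfolding W_def
        by (auto simp: ip_diff_left ip_scale_left subspace_diff subspace_scale)
    qed
    have nW: "nondegenerate W"
      unfolding nondegenerate_def
    proof (intro ballI impI)
      fix w assume w: "w \<in> W" "\<forall>w'\<in>W. ip w w' = 0"
      have "ip w z = 0" if "z \<in> V" for z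
      proof -
        from dec[OF that] obtain k where "z - k *\<^sub>R v \<in> W" by blast
        then have "ip w (z - k *\<^sub>R v) = 0" using w(2) by blast
        then show ?thesis using w(1) by (simp add: W_def ip_diff_right ip_scale_right)
      qed
      then show "w = 0" using less(3) w(1) unfolding nondegenerate_def W_def by blast
    qed
    have "v \<notin> W" using vv by (auto simp: W_def)
    moreover have "W \<subseteq> V" by (auto simp: W_def)
    ultimately have dW: "dim W < dim V"
      using dim_psubset[of W V] v sW less(2) by (metis psubsetI span_eq_iff)
    from less(1)[OF dW sW nW] obtain B where B: "finite B" "B \<subseteq> W" "span B = W" "card B \<le> dim W"
      "\<forall>b\<in>B. ip b b = 1 \<or> ip b b = - 1" "\<forall>b\<in>B. \<forall>b'\<in>B. b \<noteq> b' \<longrightarrow> ip b b' = 0" by blast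
    show ?thesis
    proof (intro exI[of _ "insert v B"] conjI)
      show "span (insert v B) = V"
      proof
        show "span (insert v B) \<subseteq> V"
          using v B(2) \<open>W \<subseteq> V\<close> less(2) by (intro span_minimal) auto
        show "V \<subseteq> span (insert v B)"
          using dec unfolding span_insert[of v B] B(3) by blast
      qed
      show "\<forall>b\<in>insert v B. \<forall>b'\<in>insert v B. b \<noteq> b' \<longrightarrow> ip b b' = 0"
      proof -
        have "ip b v = 0" if "b \<in> B" for b
          using B(2) that unfolding W_def by blast
        moreover have "ip v b = 0" if "b \<in> B" for b
          using calculation[OF that] ip_commute[of v b] by metis
        ultimately show ?thesis using B(6) by blast
      qed
      show "card (insert v B) \<le> dim V"
        using B(1,4) dW by (simp add: card_insert_if)
      show "finite (insert v B)" using B(1) by simp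
      show "insert v B \<subseteq> V" using v B(2) \<open>W \<subseteq> V\<close> by blast
      show "\<forall>b\<in>insert v B. ip b b = 1 \<or> ip b b = - 1" using vv B(5) by blast
    qed
  qed
qed

lemma orthonormal_basis_exists:
  fixes V :: "(double ^ 'n) set"
  assumes "subspace V" "nondegenerate V" "dim V = CARD('n)"
  obtains e :: "(double ^ 'n) ^ 'n" where "ordered_basis V e" "orthonormal e"
proof -
  obtain B where B: "finite B" "B \<subseteq> V" "span B = V" "card B \<le> dim V"
    "\<forall>b\<in>B. ip b b = 1 \<or> ip b b = - 1" "\<forall>b\<in>B. \<forall>b'\<in>B. b \<noteq> b' \<longrightarrow> ip b b' = 0"
    using nondegenerate_orthonormal_set[OF assms(1,2)] by blast
  have "dim V \<le> card B" using dim_le_card[of V B] B by simp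
  then have "card B = CARD('n)" using B(4) assms(3) by simp
  then obtain h where h: "bij_betw h (UNIV :: 'n set) B"
    using finite_same_card_bij[of "UNIV :: 'n set" B] B(1) by auto
  define e where "e = (\<chi> i. h i)"
  have r: "range (($) e) = B" using h by (auto simp: e_def bij_betw_def)
  have hB: "h i \<in> B" for i using h by (auto simp: bij_betw_def)
  have "ordered_basis V e"
    using assms B r hB by (intro ordered_basisI) (auto simp: e_def)
  moreover have "orthonormal e"
    unfolding orthonormal_def
  proof (intro conjI allI impI)
    show "ip (e $ i) (e $ i) = 1 \<or> ip (e $ i) (e $ i) = - 1" for i
      using B(5) hB by (simp add: e_def)
    fix i j :: 'n assume "i \<noteq> j"
    then have "h i \<noteq> h j" using bij_betw_imp_inj_on[OF h] by (simp add: inj_eq)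
    then show "ip (e $ i) (e $ j) = 0" using B(6) hB by (simp add: e_def)
  qed
  ultimately show ?thesis by (rule that)
qed

subsection \<open>Nondegenerate Lagrangian subspaces\<close>

definition nondegenerate_lagrangian :: "(double ^ 'n) set \<Rightarrow> bool" where
  "nondegenerate_lagrangian V \<longleftrightarrow> subspace V \<and> dim V = CARD('n) \<and> nondegenerate V \<and>
     (\<forall>v\<in>V. \<forall>w\<in>V. omega v w = 0)"

text \<open>Because \<open>ip (tau *s t) w = omega w t\<close>, the Lagrangian condition makes
  \<open>tau V\<close> orthogonal to \<open>V\<close>. Nondegeneracy then makes the intersection
  trivial, and the two dimensions \<open>n\<close> add up to that of the ambient space.\<close>

lemma nondegenerate_lagrangian_decompose:
  fixes V :: "(double ^ 'n) set"
  assumes "nondegenerate_lagrangian V"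
  obtains s t where "s \<in> V" "t \<in> V" "z = s + tau *s t"
proof -
  from assms have V: "subspace V" "dim V = CARD('n)" "nondegenerate V"
    and om: "\<And>v w. v \<in> V \<Longrightarrow> w \<in> V \<Longrightarrow> omega v w = 0"
    by (auto simp: nondegenerate_lagrangian_def)
  let ?W = "(*s) tau ` V"
  have inj: "inj ((*s) tau :: double ^ 'n \<Rightarrow> _)" by (metis injI tau_tau)
  have W: "subspace ?W" using linear_subspace_image[OF linear_tau V(1)] .
  have dW: "dim ?W = CARD('n)" using dim_image_eq[OF linear_tau] inj V(2) by (metis inj_on_subset subset_UNIV)
  have "V \<inter> ?W \<subseteq> {0}"
  proof
    fix x assume "x \<in> V \<inter> ?W"
    then obtain t where t: "x \<in> V" "t \<in> V" "x = tau *s t" by blast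
    have "ip x w = 0" if "w \<in> V" for w using om[OF that t(2)] by (simp add: t(3) ip_tau_left)
    then show "x \<in> {0}" using V(3) t(1) unfolding nondegenerate_def by blast
  qed
  then have d0: "dim (V \<inter> ?W) = 0" by (simp only: dim_eq_0)
  have "dim {x + y |x y. x \<in> V \<and> y \<in> ?W} = CARD('n) + CARD('n)"
    using dim_sums_Int[OF V(1) W] unfolding V(2) dW d0 by simp
  moreover have "DIM(double ^ 'n) = CARD('n) + CARD('n)"
  proof -
    have "Double 1 0 \<noteq> Double 0 1" by simp
    then show ?thesis by (simp add: Basis_double_def)
  qed
  ultimately have "span {x + y |x y. x \<in> V \<and> y \<in> ?W} = UNIV"
    unfolding dim_eq_full[symmetric] by (rule trans[OF _ sym])
  moreover have "span {x + y |x y. x \<in> V \<and> y \<in> ?W} = {x + y |x y. x \<in> V \<and> y \<in> ?W}"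
    by (rule span_eq_iff[THEN iffD2, OF subspace_sums[OF V(1) W]])
  ultimately have "{x + y |x y. x \<in> V \<and> y \<in> ?W} = UNIV" by (rule trans[OF sym, rotated])
  then have "z \<in> {x + y |x y. x \<in> V \<and> y \<in> ?W}" by simp
  then show ?thesis using that by blast
qed

lemma nondegenerate_lagrangian_normal_part:
  assumes "nondegenerate_lagrangian V" "s \<in> V" "t \<in> V"
  shows "normal_part V (s + tau *s t) = tau *s t"
  unfolding normal_part_def
proof (rule the_equality)
  from assms have V: "subspace V" "nondegenerate V"
    and om: "\<And>v w. v \<in> V \<Longrightarrow> w \<in> V \<Longrightarrow> omega v w = 0"
    by (auto simp: nondegenerate_lagrangian_def)
  show "(\<forall>w\<in>V. ip (tau *s t) w = 0) \<and> s + tau *s t - tau *s t \<in> V"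
    using om assms by (simp add: ip_tau_left)
  fix m assume m: "(\<forall>w\<in>V. ip m w = 0) \<and> s + tau *s t - m \<in> V"
  have "s + tau *s t - m - s \<in> V"
    by (rule subspace_diff[OF V(1) conjunct2[OF m] assms(2)])
  moreover have "ip (s + tau *s t - m - s) w = 0" if "w \<in> V" for w
    using m that om assms by (simp add: ip_diff_left ip_add_left ip_tau_left)
  ultimately have "s + tau *s t - m - s = 0" using V(2) unfolding nondegenerate_def by blast
  then show "m = tau *s t" by simp
qed

text \<open>The normal space is \<open>tau V\<close>. Pairing a normal part with
  \<open>tau *s w\<close> gives \<open>omega z w\<close>, as the tangential component of
  \<open>z\<close> contributes nothing; so second fundamental forms can be computed with
  \<open>omega\<close> and no explicit projection.\<close>

lemma nondegenerate_lagrangian_normal_part_props: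
  assumes "nondegenerate_lagrangian V"
  shows "normal_part V z \<in> (*s) tau ` V"
    and "w \<in> V \<Longrightarrow> ip (normal_part V z) (tau *s w) = omega z w"
proof -
  obtain s t where st: "s \<in> V" "t \<in> V" "z = s + tau *s t" using nondegenerate_lagrangian_decompose[OF assms] .
  note n = nondegenerate_lagrangian_normal_part[OF assms st(1,2)]
  show "normal_part V z \<in> (*s) tau ` V" unfolding st(3) n using st by blast
  show "ip (normal_part V z) (tau *s w) = omega z w" if "w \<in> V"
    using assms st that unfolding st(3) n
    by (simp add: ip_tau_tau omega_add_left omega_tau_left nondegenerate_lagrangian_def)
qed

lemma nondegenerate_lagrangian_normal_eqI:
  assumes "nondegenerate_lagrangian V" "h \<in> (*s) tau ` V" "h' \<in> (*s) tau ` V"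
    and eq: "\<And>w. w \<in> V \<Longrightarrow> ip h (tau *s w) = ip h' (tau *s w)"
  shows "h = h'"
proof -
  obtain t t' where t: "t \<in> V" "h = tau *s t" and t': "t' \<in> V" "h' = tau *s t'" using assms by blast
  from assms(1) have V: "subspace V" "nondegenerate V" by (auto simp: nondegenerate_lagrangian_def)
  have "ip (t - t') w = 0" if "w \<in> V" for w
    using eq[OF that] by (simp add: t t' ip_tau_tau ip_diff_left)
  moreover have "t - t' \<in> V" using t t' V by (simp add: subspace_diff)
  ultimately have "t - t' = 0" using V(2) unfolding nondegenerate_def by blast
  then show ?thesis using t t' by simp
qed

subsection \<open>Signature\<close>

lemma card_sign_sum:
  fixes e :: "(double ^ 'n) ^ 'n"
  assumes "orthonormal e"
  shows "card {i. ip (e $ i) (e $ i) = 1} + card {i. ip (e $ i) (e $ i) = - 1} = CARD('n)"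
proof -
  have "{i. ip (e $ i) (e $ i) = 1} \<union> {i. ip (e $ i) (e $ i) = - 1} = UNIV"
    using assms by (auto simp: orthonormal_def)
  then show ?thesis
    by (subst card_Un_disjoint[symmetric]) auto
qed

lemma orthonormal_inj: "orthonormal e \<Longrightarrow> inj (($) e)"
  unfolding orthonormal_def by (intro injI) (metis neg_equal_0_iff_equal one_neq_zero)

lemma orthonormal_ordered_basis:
  fixes e :: "(double ^ 'n) ^ 'n"
  assumes e: "orthonormal e" and V: "subspace V" "dim V = CARD('n)" "\<And>i. e $ i \<in> V"
  shows "ordered_basis V e"
proof -
  have "independent (range (($) e))"
  proof (rule independent_if_scalars_zero)
    fix c x assume "(\<Sum>x\<in>range (($) e). c x *\<^sub>R x) = 0" and "x \<in> range (($) e)"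
    then obtain k where "x = e $ k" "(\<Sum>i\<in>UNIV. c (e $ i) *\<^sub>R e $ i) = 0"
      using orthonormal_inj[OF e] by (auto simp: sum.reindex)
    then show "c x = 0" using orthonormal_independent[OF e, of "\<lambda>i. c (e $ i)"] by blast
  qed simp
  moreover have "card (range (($) e)) = CARD('n)" using card_image[OF orthonormal_inj[OF e]] .
  ultimately have "V \<subseteq> span (range (($) e))"
    using V card_ge_dim_independent[of "range (($) e)" V] by auto
  then show ?thesis by (intro ordered_basisI V)
qed

lemma ip_sum_sum:
  "ip (\<Sum>i\<in>S. c i *\<^sub>R x i) (\<Sum>j\<in>T. d j *\<^sub>R y j)
    = (\<Sum>i\<in>S. \<Sum>j\<in>T. c i * d j * ip (x i) (y j))"
proof -
  have "ip (x i) (\<Sum>j\<in>T. d j *\<^sub>R y j) = (\<Sum>j\<in>T. d j * ip (x i) (y j))" for i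
    by (simp add: ip_sum_right ip_scale_right)
  then show ?thesis
    by (simp add: ip_sum_left ip_scale_left sum_distrib_left mult.assoc)
qed

text \<open>
  As in Sylvester's law of inertia, the span of the \<open>E $ i\<close> with \<open>ip (e $ i) (e $ i) = \<sigma>\<close> meets the
  span of the \<open>e' $ i\<close> of the opposite sign trivially.
\<close>

lemma card_sign_le:
  fixes e e' E :: "(double ^ 'n) ^ 'n"
  assumes e: "orthonormal e" and e': "orthonormal e'" and b': "ordered_basis V e'"
    and E: "\<And>i. E $ i \<in> V"
    and near: "\<And>i j. \<bar>ip (E $ i) (E $ j) - ip (e $ i) (e $ j)\<bar> < 1 / (2 * CARD('n))"
    and \<sigma>: "\<sigma> = 1 \<or> \<sigma> = - 1"
  shows "card {i. ip (e $ i) (e $ i) = \<sigma>} \<le> card {i. ip (e' $ i) (e' $ i) = \<sigma>}"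
proof -
  let ?S = "{i. ip (e $ i) (e $ i) = \<sigma>}"
  let ?N = "{i. ip (e' $ i) (e' $ i) = - \<sigma>}"
  define n where "n = real CARD('n)"
  have n: "n > 0" by (simp add: n_def)
  have ss: "\<sigma> * \<sigma> = 1" using \<sigma> by auto
  define P where "P = span ((\<lambda>i. E $ i) ` ?S)"
  define N where "N = span ((\<lambda>i. e' $ i) ` ?N)"
  \<comment> \<open>The tolerance \<open>1 / (2 * n)\<close> is chosen for this bound: with
    \<open>c i * c j\<close> estimated by the mean of the squares, the perturbation of the Gram
    matrix costs at most half of the sum of squares, so the form times \<open>\<sigma>\<close> stays
    positive definite on \<open>P\<close>.\<close>
  have pos: "\<sigma> * ip (\<Sum>i\<in>?S. c i *\<^sub>R E $ i) (\<Sum>i\<in>?S. c i *\<^sub>R E $ i) \<ge> (\<Sum>i\<in>?S. (c i)\<^sup>2) / 2" for c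
  proof -
    define d where "d = 1 / (2 * n)"
    have summand: "c i * c j * (\<sigma> * ip (E $ i) (E $ j)) \<ge>
        (if i = j then (c i)\<^sup>2 else 0) - d * ((c i)\<^sup>2 + (c j)\<^sup>2) / 2" if "i \<in> ?S" "j \<in> ?S" for i j
    proof -
      define r where "r = \<sigma> * ip (E $ i) (E $ j) - \<sigma> * ip (e $ i) (e $ j)"
      have "\<bar>r\<bar> = \<bar>ip (E $ i) (E $ j) - ip (e $ i) (e $ j)\<bar>"
        using \<sigma> by (auto simp: r_def)
      then have r: "\<bar>r\<bar> \<le> d" using near[of i j] by (simp add: d_def n_def)
      have "\<bar>c i * c j\<bar> \<le> ((c i)\<^sup>2 + (c j)\<^sup>2) / 2"
        using sum_squares_bound[of "\<bar>c i\<bar>" "\<bar>c j\<bar>"] by (simp add: abs_mult)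
      then have "\<bar>c i * c j * r\<bar> \<le> ((c i)\<^sup>2 + (c j)\<^sup>2) / 2 * d"
        unfolding abs_mult[of "c i * c j"] using r by (intro mult_mono) auto
      moreover have "c i * c j * (\<sigma> * ip (e $ i) (e $ j)) = (if i = j then (c i)\<^sup>2 else 0)"
        using e that ss by (auto simp: orthonormal_def power2_eq_square)
      moreover have "c i * c j * (\<sigma> * ip (E $ i) (E $ j)) =
          c i * c j * (\<sigma> * ip (e $ i) (e $ j)) + c i * c j * r"
        by (simp add: r_def algebra_simps)
      ultimately show ?thesis by (simp add: abs_le_iff mult.commute)
    qed
    have "(\<Sum>i\<in>?S. \<Sum>j\<in>?S. (if i = j then (c i)\<^sup>2 else 0) - d * ((c i)\<^sup>2 + (c j)\<^sup>2) / 2)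
       = (\<Sum>i\<in>?S. (c i)\<^sup>2) - d * card ?S * (\<Sum>i\<in>?S. (c i)\<^sup>2)"
    proof -
      have "(\<Sum>i\<in>?S. \<Sum>j\<in>?S. d * ((c i)\<^sup>2 + (c j)\<^sup>2) / 2) = d * card ?S * (\<Sum>i\<in>?S. (c i)\<^sup>2)"
        by (simp add: sum.distrib sum_divide_distrib[symmetric] sum_distrib_left[symmetric] distrib_left)
      then show ?thesis by (simp add: sum_subtractf sum.delta)
    qed
    moreover have "d * card ?S * (\<Sum>i\<in>?S. (c i)\<^sup>2) \<le> 1 / 2 * (\<Sum>i\<in>?S. (c i)\<^sup>2)"
    proof (intro mult_right_mono sum_nonneg)
      have "real (card ?S) \<le> n" unfolding n_def by (simp add: card_mono)
      then show "d * card ?S \<le> 1 / 2" using n by (simp add: d_def field_simps)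
    qed auto
    moreover have "\<sigma> * ip (\<Sum>i\<in>?S. c i *\<^sub>R E $ i) (\<Sum>i\<in>?S. c i *\<^sub>R E $ i)
       = (\<Sum>i\<in>?S. \<Sum>j\<in>?S. c i * c j * (\<sigma> * ip (E $ i) (E $ j)))"
      by (simp add: ip_sum_sum sum_distrib_left mult_ac)
    moreover have "\<dots> \<ge> (\<Sum>i\<in>?S. \<Sum>j\<in>?S. (if i = j then (c i)\<^sup>2 else 0) - d * ((c i)\<^sup>2 + (c j)\<^sup>2) / 2)"
      by (intro sum_mono summand)
    ultimately show ?thesis by linarith
  qed
  have zero: "c k = 0" if "(\<Sum>i\<in>?S. c i *\<^sub>R E $ i) = 0" "k \<in> ?S" for c k
  proof -
    have "(\<Sum>i\<in>?S. (c i)\<^sup>2) \<le> 0" using pos[of c] by (simp add: that(1))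
    moreover have "(c k)\<^sup>2 \<le> (\<Sum>i\<in>?S. (c i)\<^sup>2)" using that(2) by (intro member_le_sum) auto
    ultimately show ?thesis by (metis order.trans power2_less_eq_zero_iff)
  qed
  have injE: "inj_on (($) E) ?S"
  proof (rule inj_onI, rule ccontr)
    fix i j assume ij: "i \<in> ?S" "j \<in> ?S" "E $ i = E $ j" "i \<noteq> j"
    \<comment> \<open>The coefficients of \<open>E $ i - E $ j\<close>, which would be a nontrivial
      relation.\<close>
    let ?c = "\<lambda>l. (if l = i then 1 else 0) - (if l = j then 1 else 0 :: real)"
    have "(\<Sum>l\<in>?S. ?c l *\<^sub>R E $ l) = 0"
      using ij by (simp add: scaleR_diff_left sum_subtractf if_distrib[of "\<lambda>x. x *\<^sub>R _"] cong: if_cong)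
    then have "?c i = 0" using zero[of ?c i] ij by blast
    then show False using ij by simp
  qed
  have ind: "independent (($) E ` ?S)"
  proof (rule independent_if_scalars_zero)
    fix c x assume "(\<Sum>x\<in>($) E ` ?S. c x *\<^sub>R x) = 0" and x: "x \<in> ($) E ` ?S"
    then have "(\<Sum>i\<in>?S. c (E $ i) *\<^sub>R E $ i) = 0"
      using injE by (simp add: sum.reindex)
    then show "c x = 0" using zero[of "\<lambda>i. c (E $ i)"] x by blast
  qed simp
  have dP: "dim P = card ?S"
    unfolding P_def dim_span_eq_card_independent[OF ind] by (rule card_image[OF injE])
  have inje': "inj_on (($) e') ?N" using orthonormal_inj[OF e'] inj_on_subset by blast
  have ind': "independent (($) e' ` ?N)"
    using b' unfolding ordered_basis_def by (meson independent_mono image_mono subset_UNIV)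
  have dN: "dim N = card ?N"
    unfolding N_def dim_span_eq_card_independent[OF ind'] by (rule card_image[OF inje'])
  have neg: "\<sigma> * ip (\<Sum>i\<in>?N. c i *\<^sub>R e' $ i) (\<Sum>i\<in>?N. c i *\<^sub>R e' $ i) \<le> 0" for c
  proof -
    have "ip (\<Sum>i\<in>?N. c i *\<^sub>R e' $ i) (\<Sum>i\<in>?N. c i *\<^sub>R e' $ i)
      = (\<Sum>i\<in>?N. \<Sum>j\<in>?N. c i * c j * ip (e' $ i) (e' $ j))"
      by (rule ip_sum_sum)
    also have "\<dots> = (\<Sum>i\<in>?N. \<Sum>j\<in>?N. if i = j then - (\<sigma> * (c i)\<^sup>2) else 0)"
      using e' by (intro sum.cong refl) (auto simp: orthonormal_def power2_eq_square)
    also have "\<dots> = - (\<sigma> * (\<Sum>i\<in>?N. (c i)\<^sup>2))" by (simp add: sum.delta sum_negf sum_distrib_left)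
    finally have "\<sigma> * ip (\<Sum>i\<in>?N. c i *\<^sub>R e' $ i) (\<Sum>i\<in>?N. c i *\<^sub>R e' $ i) = - (\<Sum>i\<in>?N. (c i)\<^sup>2)"
      using ss by simp
    then show ?thesis by (simp add: sum_nonneg)
  qed
  have rep: "\<exists>c. x = (\<Sum>i\<in>T. c i *\<^sub>R G $ i)" if "x \<in> span (($) G ` T)" "inj_on (($) G) T"
    for x and G :: "(double ^ 'n) ^ 'n" and T
  proof -
    from that(1) obtain r where "x = (\<Sum>y\<in>($) G ` T. r y *\<^sub>R y)"
      unfolding span_finite[OF finite_imageI[OF finite]] by auto
    then show ?thesis using that(2) by (auto simp: sum.reindex intro!: exI[of _ "\<lambda>i. r (G $ i)"])
  qed
  have "P \<inter> N \<subseteq> {0}"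
  proof
    fix x assume x: "x \<in> P \<inter> N"
    obtain c where c: "x = (\<Sum>i\<in>?S. c i *\<^sub>R E $ i)" using x rep[OF _ injE] unfolding P_def by blast
    obtain c' where c': "x = (\<Sum>i\<in>?N. c' i *\<^sub>R e' $ i)" using x rep[OF _ inje'] unfolding N_def by blast
    have "\<sigma> * ip x x \<le> 0" using neg[of c'] c' by simp
    then have "(\<Sum>i\<in>?S. (c i)\<^sup>2) \<le> 0" using pos[of c] c by simp
    then have "(\<Sum>i\<in>?S. (c i)\<^sup>2) = 0" by (meson antisym sum_nonneg zero_le_power2)
    then have "\<forall>i\<in>?S. (c i)\<^sup>2 = 0" by (subst (asm) sum_nonneg_eq_0_iff) auto
    then have "x = 0" unfolding c by simp
    then show "x \<in> {0}" by simp
  qed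
  then have d0: "dim (P \<inter> N) = 0" by (simp only: dim_eq_0)
  \<comment> \<open>\<open>P\<close> and \<open>N\<close> together fit into \<open>V\<close>, so the
    size of \<open>?S\<close> is at most \<open>n\<close> minus the number of opposite signs of
    \<open>e'\<close>, which is the number of signs \<open>\<sigma>\<close> of
    \<open>e'\<close>.\<close>
  have "dim {x + y |x y. x \<in> P \<and> y \<in> N} = card ?S + card ?N"
    using dim_sums_Int[of P N] unfolding d0 dP dN by (simp add: P_def N_def)
  moreover have "dim {x + y |x y. x \<in> P \<and> y \<in> N} \<le> dim V"
  proof (rule dim_subset)
    have sV: "subspace V" using ordered_basis_subspace[OF b'] .
    have "P \<subseteq> V" "N \<subseteq> V"
      unfolding P_def N_def using E ordered_basis_in[OF b'] by (intro span_minimal sV; blast)+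
    then show "{x + y |x y. x \<in> P \<and> y \<in> N} \<subseteq> V" using subspace_add[OF sV] by blast
  qed
  moreover have "card {i. ip (e' $ i) (e' $ i) = \<sigma>} + card ?N = CARD('n)"
    using card_sign_sum[OF e'] \<sigma> by auto
  ultimately show ?thesis using ordered_basis_dim[OF b'] by linarith
qed

subsection \<open>Smooth maps\<close>

lemma Ck_on_cong:
  assumes "open U" "\<And>x. x \<in> U \<Longrightarrow> f x = g x"
  shows "Ck_on k U f \<Longrightarrow> Ck_on k U g"
  using assms(2)
proof (induction k arbitrary: f g)
  case 0
  then show ?case by (simp cong: continuous_on_cong)
next
  case (Suc k)
  have df: "f differentiable at x" if "x \<in> U" for x using Suc.prems that by simp
  have eq: "frechet_derivative f (at x) = frechet_derivative g (at x)" if "x \<in> U" for x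
    using frechet_derivative_transform_within_open[OF df assms(1)] that Suc.prems(2) by blast
  have "g differentiable at x" if "x \<in> U" for x
    using df[OF that] Suc.prems(2) assms(1) that
    unfolding differentiable_def by (meson has_derivative_transform_within_open)
  moreover have "Ck_on k U (\<lambda>x. frechet_derivative g (at x) v)" for v
  proof (rule Suc.IH)
    show "Ck_on k U (\<lambda>x. frechet_derivative f (at x) v)" using Suc.prems by simp
  qed (use eq in simp)
  ultimately show ?case by simp
qed

lemma smooth_on_cong:
  assumes "open U" "\<And>x. x \<in> U \<Longrightarrow> f x = g x" "smooth_on U f"
  shows "smooth_on U g"
  unfolding smooth_on_def
proof
  fix k
  have "Ck_on k U f" using assms(3) unfolding smooth_on_def by (rule spec)
  then show "Ck_on k U g" using Ck_on_cong[of U f g k] assms(1,2) by blast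
qed

lemma smooth_on_const: "smooth_on U (\<lambda>_. c)"
proof -
  have "Ck_on k U (\<lambda>_. c)" for k
  proof (induction k arbitrary: c)
    case (Suc k)
    have "frechet_derivative (\<lambda>_. c) (at x) = (\<lambda>_. 0)" for x :: 'a
      using frechet_derivative_at[OF has_derivative_const] by metis
    then show ?case using Suc by simp
  qed simp
  then show ?thesis by (simp add: smooth_on_def)
qed

lemma smooth_on_frechet_derivative:
  assumes "smooth_on U f" shows "smooth_on U (\<lambda>x. frechet_derivative f (at x) v)"
  unfolding smooth_on_def
proof
  fix k
  have "Ck_on (Suc k) U f" using assms unfolding smooth_on_def by (rule spec)
  then show "Ck_on k U (\<lambda>x. frechet_derivative f (at x) v)" by simp
qed

lemma smooth_on_has_derivative:
  assumes "smooth_on U f" "x \<in> U" shows "(f has_derivative frechet_derivative f (at x)) (at x)"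
proof -
  have "Ck_on (Suc 0) U f" using assms(1) unfolding smooth_on_def by (rule spec)
  then show ?thesis using assms(2) by (simp add: frechet_derivative_works)
qed

lemma smooth_on_continuous:
  assumes "smooth_on U f" shows "continuous_on U f"
proof -
  have "Ck_on 0 U f" using assms unfolding smooth_on_def by (rule spec)
  then show ?thesis by simp
qed

abbreviation fd :: "('a::real_normed_vector \<Rightarrow> 'b::real_normed_vector) \<Rightarrow> 'a \<Rightarrow> 'a \<Rightarrow> 'b" where
  "fd f u \<equiv> frechet_derivative f (at u)"

abbreviation fd2 :: "('a::real_normed_vector \<Rightarrow> 'b::real_normed_vector) \<Rightarrow> 'a \<Rightarrow> 'a \<Rightarrow> 'a \<Rightarrow> 'b" where
  "fd2 f u a b \<equiv> frechet_derivative (\<lambda>x. frechet_derivative f (at x) b) (at u) a"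

subsection \<open>Local parametrizations\<close>

lemma local_paramD:
  assumes "local_param M U f"
  shows "open U" "smooth_on U f" "u \<in> U \<Longrightarrow> inj (fd f u)" "openin (top_of_set M) (f ` U)" "f ` U \<subseteq> M"
    "u \<in> U \<Longrightarrow> (f has_derivative fd f u) (at u)"
    "u \<in> U \<Longrightarrow> ((\<lambda>x. fd f x b) has_derivative (\<lambda>a. fd2 f u a b)) (at u)"
    "continuous_on U (\<lambda>u. fd2 f u a b)"
    "u \<in> U \<Longrightarrow> linear (fd f u)"
proof -
  show *: "open U" "smooth_on U f" "u \<in> U \<Longrightarrow> inj (fd f u)" "openin (top_of_set M) (f ` U)"
    using assms by (auto simp: local_param_def)
  then show "f ` U \<subseteq> M" using openin_imp_subset by blast
  show "u \<in> U \<Longrightarrow> (f has_derivative fd f u) (at u)"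
    using smooth_on_has_derivative * by blast
  then show "u \<in> U \<Longrightarrow> linear (fd f u)" using has_derivative_linear by blast
  show "u \<in> U \<Longrightarrow> ((\<lambda>x. fd f x b) has_derivative (\<lambda>a. fd2 f u a b)) (at u)"
    using smooth_on_has_derivative smooth_on_frechet_derivative * by blast
  show "continuous_on U (\<lambda>u. fd2 f u a b)"
    using smooth_on_continuous smooth_on_frechet_derivative * by blast
qed

text \<open>The transition map is \<open>g \<circ> f1\<close> with \<open>g\<close> the continuous
  inverse of \<open>f2\<close>. It is defined near \<open>u1\<close> because the image of
  \<open>f2\<close> is open in \<open>M\<close>, and differentiable because it lifts
  \<open>f1\<close> through the immersion \<open>f2\<close>.\<close>

lemma local_param_transition:
  assumes p1: "local_param M U1 f1" and p2: "local_param M U2 f2"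
    and u: "u1 \<in> U1" "u2 \<in> U2" "f1 u1 = f2 u2"
  obtains \<phi> \<phi>' where "\<phi> u1 = u2" "(\<phi> has_derivative \<phi>') (at u1)"
    "\<And>h. fd f2 u2 (\<phi>' h) = fd f1 u1 h" "\<forall>\<^sub>F u in nhds u1. u \<in> U1 \<and> \<phi> u \<in> U2 \<and> f2 (\<phi> u) = f1 u"
proof -
  obtain g where g: "homeomorphism U2 (f2 ` U2) f2 g" using p2 by (auto simp: local_param_def)
  let ?\<phi> = "\<lambda>u. g (f1 u)"
  have c1: "continuous_on U1 f1" using local_paramD(2)[OF p1] smooth_on_continuous by blast
  have "openin (top_of_set U1) (U1 \<inter> f1 -` (f2 ` U2))"
    by (rule continuous_openin_preimage[OF c1 _ local_paramD(4)[OF p2]])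
      (use local_paramD(5)[OF p1] in auto)
  then have op: "open (U1 \<inter> f1 -` (f2 ` U2))"
    by (rule openin_open_trans[OF _ local_paramD(1)[OF p1]])
  have u1: "u1 \<in> U1 \<inter> f1 -` (f2 ` U2)" using u by auto
  have ev: "\<forall>\<^sub>F u in nhds u1. u \<in> U1 \<inter> f1 -` (f2 ` U2)"
    using op u1 by (rule eventually_nhds_in_open)
  have gs: "g (f2 u) = u" if "u \<in> U2" for u using g that by (auto simp: homeomorphism_def)
  have ev2: "\<forall>\<^sub>F u in nhds u1. u \<in> U1 \<and> ?\<phi> u \<in> U2 \<and> f2 (?\<phi> u) = f1 u"
    using ev by eventually_elim (auto simp: gs)
  have \<phi>u: "?\<phi> u1 = u2" using u gs by simp
  have "continuous_on (U1 \<inter> f1 -` (f2 ` U2)) ?\<phi>"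
    by (rule continuous_on_compose2[OF homeomorphism_cont2[OF g]])
      (use c1 in \<open>auto intro: continuous_on_subset\<close>)
  then have "isCont ?\<phi> u1" using op u1 continuous_on_eq_continuous_at by blast
  moreover have "\<forall>\<^sub>F u in nhds u1. f2 (?\<phi> u) = f1 u" using ev2 by eventually_elim simp
  ultimately obtain \<phi>' where "(?\<phi> has_derivative \<phi>') (at u1)" "\<forall>h. fd f2 u2 (\<phi>' h) = fd f1 u1 h"
    using has_derivative_lift_immersion[of f2 "fd f2 u2" ?\<phi> u1 f1 "fd f1 u1"]
      local_paramD(3,6)[OF p2 u(2)] local_paramD(6)[OF p1 u(1)] \<phi>u by auto
  then show ?thesis using that[of ?\<phi> \<phi>'] \<phi>u ev2 by blast
qed

text \<open>\<open>tangent_space\<close> collects vectors from all parametrizations through the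
  point; the derivative of a transition map carries each of them into the range of any fixed
  one.\<close>

lemma tangent_space_param:
  assumes p: "local_param M U f" and u: "u \<in> U"
  shows "tangent_space M (f u) = range (fd f u)"
proof
  show "range (fd f u) \<subseteq> tangent_space M (f u)"
    using assms unfolding tangent_space_def by blast
  show "tangent_space M (f u) \<subseteq> range (fd f u)"
  proof
    fix v assume "v \<in> tangent_space M (f u)"
    then obtain U' f' u' a where *: "v = fd f' u' a" "local_param M U' f'" "u' \<in> U'" "f' u' = f u"
      unfolding tangent_space_def by blast
    obtain \<phi>' where "\<And>h. fd f u (\<phi>' h) = fd f' u' h"
      using local_param_transition[OF *(2) p *(3) u *(4)] by blast
    then have "v = fd f u (\<phi>' a)" using *(1) by simp
    then show "v \<in> range (fd f u)" by blast
  qed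
qed

subsection \<open>Second fundamental form and mean curvature\<close>

lemma bounded_bilinear_omega: "bounded_bilinear (omega :: double ^ 'n \<Rightarrow> double ^ 'n \<Rightarrow> real)"
  using bilinear_omega by (simp only: bilinear_conv_bounded_bilinear)

lemma tangent_space_nondegenerate_lagrangian:
  fixes M :: "(double ^ 'n) set"
  assumes "submanifold M" "lagrangian M" "nondegenerate_submanifold M" "x \<in> M"
  shows "nondegenerate_lagrangian (tangent_space M x)"
proof -
  obtain U f where p: "local_param M U f" and "x \<in> f ` U"
    using assms(1,4) unfolding submanifold_def by blast
  then obtain u where u: "u \<in> U" "x = f u" by blast
  note T = tangent_space_param[OF p u(1), folded u(2)]
  note lin = local_paramD(9)[OF p u(1)]
  have "subspace (tangent_space M x)"
    unfolding T using linear_subspace_image[OF lin subspace_UNIV] .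
  moreover have "dim (tangent_space M x) = CARD('n)"
    unfolding T using dim_image_eq[OF lin, of UNIV] local_paramD(3)[OF p u(1)]
    by (simp add: inj_on_def)
  ultimately show ?thesis
    using assms unfolding nondegenerate_lagrangian_def lagrangian_def nondegenerate_submanifold_def by blast
qed

lemma local_param_omega:
  assumes "lagrangian M" "local_param M U f" "u \<in> U"
  shows "omega (fd f u a) (fd f u b) = 0"
proof -
  have "f u \<in> M" using local_paramD(5)[OF assms(2)] assms(3) by blast
  moreover have "fd f u a \<in> tangent_space M (f u)" "fd f u b \<in> tangent_space M (f u)"
    unfolding tangent_space_param[OF assms(2,3)] by (rule rangeI)+
  ultimately show ?thesis using assms(1) unfolding lagrangian_def by blast
qed

text \<open>Symmetry is available for real functions, so it is applied to
  \<open>omega (f x) w\<close>. Second derivatives of \<open>f\<close> only need to be exchanged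
  inside \<open>omega\<close>.\<close>

lemma fd2_symmetric:
  assumes p: "local_param M U f" and u: "u \<in> U"
  shows "omega (fd2 f u a b) w = omega (fd2 f u b a) w"
proof -
  note bb = bounded_bilinear.bounded_linear_left[OF bounded_bilinear_omega, of w]
  have "omega (fd2 f u b a) w = omega (fd2 f u a b) w"
  proof (rule symmetric_second_derivative[of U u "\<lambda>x. omega (f x) w" "\<lambda>x h. omega (fd f x h) w"
        a "\<lambda>x h. omega (fd2 f x h a) w" b "\<lambda>x h. omega (fd2 f x h b) w"])
    show "continuous_on U (\<lambda>x. omega (fd2 f x b a) w)" "continuous_on U (\<lambda>x. omega (fd2 f x a b) w)"
      using local_paramD(8)[OF p] by (intro bounded_linear.continuous_on[OF bb]; blast)+
  qed (use local_paramD(1,6,7)[OF p] u in \<open>auto intro!: bounded_linear.has_derivative[OF bb]\<close>)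
  then show ?thesis by simp
qed

text \<open>
  Differentiating \<open>omega W X = 0\<close> for tangent fields \<open>W\<close>, \<open>X\<close> shows that the normal component of
  the derivative of \<open>W\<close> depends only on the value of \<open>W\<close> at the point.
\<close>

lemma omega_derivative_tangent_field:
  assumes lag: "lagrangian M" and p: "local_param M U f" and u: "u \<in> U"
    and V: "(V has_derivative V') (at u)"
    and ev: "\<forall>\<^sub>F y in nhds u. y \<in> U \<and> V y \<in> range (fd f y)"
  shows "omega (V' a) (fd f u c) = - omega (V u) (fd2 f u a c)"
proof -
  have d: "((\<lambda>y. omega (V y) (fd f y c)) has_derivative
      (\<lambda>a. omega (V u) (fd2 f u a c) + omega (V' a) (fd f u c))) (at u)"
    using bounded_bilinear.FDERIV[OF bounded_bilinear_omega V local_paramD(7)[OF p u]] .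
  have ev0: "\<forall>\<^sub>F y in nhds u. omega (V y) (fd f y c) = 0"
    using ev by eventually_elim (use local_param_omega[OF lag p] in auto)
  have "((\<lambda>y. 0) has_derivative
      (\<lambda>a. omega (V u) (fd2 f u a c) + omega (V' a) (fd f u c))) (at u)"
    by (rule has_derivative_transform_eventually[OF d])
      (use ev0 eventually_nhds_x_imp_x[OF ev0] in \<open>auto simp: eventually_at_filter elim: eventually_mono\<close>)
  then have "(\<lambda>a. omega (V u) (fd2 f u a c) + omega (V' a) (fd f u c)) = (\<lambda>a. 0)"
    using has_derivative_unique has_derivative_const by blast
  then have "omega (V u) (fd2 f u a c) + omega (V' a) (fd f u c) = 0" by (rule fun_cong)
  then show ?thesis by simp
qed

text \<open>The coordinate fields are tangent fields. Together with \<open>fd2_symmetric\<close>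
  this exchange of the last two slots generates all permutations of the cubic form.\<close>

lemma omega_fd2_swap:
  assumes lag: "lagrangian M" and p: "local_param M U f" and u: "u \<in> U"
  shows "omega (fd2 f u a b) (fd f u c) = omega (fd2 f u a c) (fd f u b)"
proof -
  have "omega (fd2 f u a b) (fd f u c) = - omega (fd f u b) (fd2 f u a c)"
    by (rule omega_derivative_tangent_field[OF lag p u local_paramD(7)[OF p u]])
      (use eventually_nhds_in_open[OF local_paramD(1)[OF p] u] in \<open>auto elim: eventually_mono\<close>)
  then show ?thesis using omega_commute by metis
qed

text \<open>Well-definedness of the second fundamental form. A competing field, given in another
  parametrization, is pulled back along the transition map; differentiating \<open>omega = 0\<close>
  shows that the normal part sees only its value at the point, which is shared with the coordinate
  field.\<close>

lemma second_fundamental_form_param: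
  fixes M :: "(double ^ 'n) set"
  assumes sub: "submanifold M" and lag: "lagrangian M" and nd: "nondegenerate_submanifold M"
    and p: "local_param M U f" and u: "u \<in> U"
  shows "second_fundamental_form M (f u) (fd f u a) (fd f u b)
    = normal_part (tangent_space M (f u)) (fd2 f u a b)"
  unfolding second_fundamental_form_def
proof (rule the_equality)
  have fM: "f u \<in> M" using local_paramD(5)[OF p] u by blast
  note ls = tangent_space_nondegenerate_lagrangian[OF sub lag nd fM]
  obtain g where g: "homeomorphism U (f ` U) f g" using p by (auto simp: local_param_def)
  have gs: "g (f y) = y" if "y \<in> U" for y using g that by (auto simp: homeomorphism_def)
  \<comment> \<open>The coordinate field in direction \<open>b\<close>, carried to \<open>M\<close>
    by the inverse of \<open>f\<close>.\<close>
  define W where "W = (\<lambda>y. fd f (g y) b)"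
  have W: "(W \<circ> f) y = fd f y b" if "y \<in> U" for y using gs[OF that] by (simp add: W_def)
  show "\<exists>U' f' W u' a'. local_param M U' f' \<and> smooth_on U' (W \<circ> f') \<and>
      (\<forall>y\<in>f' ` U'. W y \<in> tangent_space M y) \<and> W (f u) = fd f u b \<and> u' \<in> U' \<and> f' u' = f u \<and>
      fd f' u' a' = fd f u a \<and>
      normal_part (tangent_space M (f u)) (fd2 f u a b) =
        normal_part (tangent_space M (f u)) (fd (W \<circ> f') u' a')"
  proof (intro exI conjI)
    show "smooth_on U (W \<circ> f)"
      using smooth_on_cong[of U "\<lambda>y. fd f y b" "W \<circ> f"] W local_paramD(1,2)[OF p]
        smooth_on_frechet_derivative by metis
    show "\<forall>y\<in>f ` U. W y \<in> tangent_space M y"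
      using tangent_space_param[OF p] W by auto
    show "W (f u) = fd f u b" using W[OF u] by simp
    have "((\<lambda>x. fd f x b) has_derivative (\<lambda>a. fd2 f u a b)) (at u)" by (rule local_paramD(7)[OF p u])
    then have "((W \<circ> f) has_derivative (\<lambda>a. fd2 f u a b)) (at u)"
      by (rule has_derivative_transform_within_open[OF _ local_paramD(1)[OF p] u]) (rule W[symmetric])
    then have "fd (W \<circ> f) u = (\<lambda>a. fd2 f u a b)" using frechet_derivative_at by metis
    then show "normal_part (tangent_space M (f u)) (fd2 f u a b) =
        normal_part (tangent_space M (f u)) (fd (W \<circ> f) u a)" by simp
  qed (use p u in auto)
  fix h
  assume "\<exists>U' f' W u' a'. local_param M U' f' \<and> smooth_on U' (W \<circ> f') \<and>
      (\<forall>y\<in>f' ` U'. W y \<in> tangent_space M y) \<and> W (f u) = fd f u b \<and> u' \<in> U' \<and> f' u' = f u \<and>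
      fd f' u' a' = fd f u a \<and> h = normal_part (tangent_space M (f u)) (fd (W \<circ> f') u' a')"
  then obtain U' f' W u' a' where p': "local_param M U' f'" and sm: "smooth_on U' (W \<circ> f')"
    and WT: "\<forall>y\<in>f' ` U'. W y \<in> tangent_space M y" and Wu: "W (f u) = fd f u b"
    and u': "u' \<in> U'" "f' u' = f u" and a': "fd f' u' a' = fd f u a"
    and h: "h = normal_part (tangent_space M (f u)) (fd (W \<circ> f') u' a')" by blast
  obtain \<phi> \<phi>' where \<phi>: "\<phi> u = u'" "(\<phi> has_derivative \<phi>') (at u)"
    and \<phi>': "\<And>h. fd f' u' (\<phi>' h) = fd f u h"
    and ev: "\<forall>\<^sub>F y in nhds u. y \<in> U \<and> \<phi> y \<in> U' \<and> f' (\<phi> y) = f y"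
    by (rule local_param_transition[OF p p' u u'(1) u'(2)[symmetric]]) blast
  have "\<phi>' a = a'" using \<phi>'[of a] a' local_paramD(3)[OF p' u'(1)] by (metis injD)
  have dW: "((W \<circ> f') has_derivative fd (W \<circ> f') (\<phi> u)) (at (\<phi> u))"
    using smooth_on_has_derivative[OF sm] u' \<phi>(1) by simp
  have V: "((\<lambda>y. (W \<circ> f') (\<phi> y)) has_derivative (\<lambda>k. fd (W \<circ> f') u' (\<phi>' k))) (at u)"
    using has_derivative_compose[OF \<phi>(2) dW] \<phi>(1) by simp
  have ev': "\<forall>\<^sub>F y in nhds u. y \<in> U \<and> (W \<circ> f') (\<phi> y) \<in> range (fd f y)"
    using ev
  proof eventually_elim
    case (elim y)
    then have "W (f' (\<phi> y)) \<in> tangent_space M (f y)" using WT by force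
    then show ?case using elim tangent_space_param[OF p] by simp
  qed
  \<comment> \<open>Against tangent vectors \<open>omega\<close> determines the normal part, so
    agreement here suffices. The field \<open>W\<close> enters the right-hand side only through
    \<open>W (f u)\<close>.\<close>
  have eq: "omega (fd (W \<circ> f') u' a') (fd f u c) = omega (fd2 f u a b) (fd f u c)" for c
  proof -
    have "omega (fd (W \<circ> f') u' (\<phi>' a)) (fd f u c) = - omega ((W \<circ> f') (\<phi> u)) (fd2 f u a c)"
      by (rule omega_derivative_tangent_field[OF lag p u V ev'])
    also have "(W \<circ> f') (\<phi> u) = fd f u b" using \<phi>(1) u'(2) Wu by simp
    also have "- omega (fd f u b) (fd2 f u a c) = omega (fd2 f u a b) (fd f u c)"
      using omega_commute[of "fd2 f u a c" "fd f u b"] omega_fd2_swap[OF lag p u, where a=a and b=b and c=c] by simp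
    finally show ?thesis unfolding \<open>\<phi>' a = a'\<close> .
  qed
  show "h = normal_part (tangent_space M (f u)) (fd2 f u a b)"
    unfolding h
  proof (rule nondegenerate_lagrangian_normal_eqI[OF ls nondegenerate_lagrangian_normal_part_props(1)[OF ls]
        nondegenerate_lagrangian_normal_part_props(1)[OF ls]])
    fix w assume w: "w \<in> tangent_space M (f u)"
    then obtain c where "w = fd f u c" using tangent_space_param[OF p u] by blast
    then show "ip (normal_part (tangent_space M (f u)) (fd (W \<circ> f') u' a')) (tau *s w)
        = ip (normal_part (tangent_space M (f u)) (fd2 f u a b)) (tau *s w)"
      using nondegenerate_lagrangian_normal_part_props(2)[OF ls w] eq by simp
  qed
qed

section \<open>The mean curvature in the logarithmic derivative of the form
  \<open>dz\<close>\<close>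

definition frame_trace :: "(double ^ 'n) set \<Rightarrow> double ^ 'n \<Rightarrow> (double ^ 'n) ^ 'n \<Rightarrow> double ^ 'n" where
  "frame_trace M x e =
    (\<Sum>i\<in>UNIV. ip (e $ i) (e $ i) *\<^sub>R second_fundamental_form M x (e $ i) (e $ i))"

text \<open>Jacobi's formula for a matrix function with derivative \<open>K F\<close>: in each row
  only the diagonal coefficient contributes, which adds up to the trace of \<open>K\<close>.\<close>

lemma has_derivative_det_rowwise:
  fixes F :: "'a::real_normed_vector \<Rightarrow> real ^ 'n ^ 'n"
  assumes F: "\<And>i j. ((\<lambda>y. F y $ i $ j) has_derivative F' i j) (at x)"
    and K: "\<And>h i j. F' i j h = (\<Sum>l\<in>UNIV. K h i l * F x $ l $ j)"
  shows "((\<lambda>y. det (F y)) has_derivative (\<lambda>h. (\<Sum>i\<in>UNIV. K h i i) * det (F x))) (at x)"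
proof -
  have "det (\<chi> k. if k = i then (\<chi> j. F' i j h) else F x $ k) = K h i i * det (F x)" for h i
  proof -
    have "(\<chi> j. F' i j h) = (\<Sum>l\<in>UNIV. K h i l *\<^sub>R F x $ l)"
      by (simp add: vec_eq_iff K)
    then show ?thesis using det_replace_row_by_combination[of i "K h i" "F x"] by (simp only:)
  qed
  then show ?thesis
    using has_derivative_det[of F F' x, OF F] by (simp add: sum_distrib_right)
qed

lemma coordinate_frame_transform:
  assumes "linear (fd f u)"
  shows "transform (coordinate_frame f u) (\<chi> i j. b j $ i) = (\<chi> j. fd f u (b j))"
proof -
  have "fd f u (b j) = (\<Sum>i\<in>UNIV. b j $ i *\<^sub>R fd f u (axis i 1))" for j
  proof -
    have "b j = (\<Sum>i\<in>UNIV. b j $ i *\<^sub>R axis i 1)"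
      using basis_expansion[of "b j"] by (simp add: scalar_mult_eq_scaleR)
    then have "fd f u (b j) = fd f u (\<Sum>i\<in>UNIV. b j $ i *\<^sub>R axis i 1)" by simp
    then show ?thesis by (simp add: linear_sum[OF assms] linear_cmul[OF assms])
  qed
  then show ?thesis by (simp add: transform_def coordinate_frame_def vec_eq_iff)
qed

lemma pl_mi_dz_orthonormal:
  assumes "orthonormal e" "\<And>i k. omega (e $ i) (e $ k) = 0"
  shows "pl (dz e) * mi (dz e) = (- 1) ^ card {i. ip (e $ i) (e $ i) = - 1}"
  unfolding pl_dz_mult_mi_dz[OF assms(2)] by (rule det_gram_orthonormal[OF assms(1)])

text \<open>Here \<open>\<alpha>\<close> is \<open>tr A\<close>. It may stay anonymous, because it
  enters both null components alike whereas the trace vector enters them with opposite signs, so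
  comparing the two isolates the latter.\<close>

lemma frame_trace_props:
  fixes M :: "(double ^ 'n) set"
  assumes sub: "submanifold M" and lag: "lagrangian M" and nd: "nondegenerate_submanifold M"
    and p: "local_param M U f" and u: "u \<in> U"
    and e: "ordered_basis (tangent_space M (f u)) e" "orthonormal e"
  shows "frame_trace M (f u) e \<in> (*s) tau ` tangent_space M (f u)" (is ?normal)
    and "\<exists>\<alpha>. ((\<lambda>y. pl (dz (coordinate_frame f y))) has_derivative
        (\<lambda>a. (\<alpha> a - ip (frame_trace M (f u) e) (tau *s fd f u a)) * pl (dz (coordinate_frame f u)))) (at u)
      \<and> ((\<lambda>y. mi (dz (coordinate_frame f y))) has_derivative
        (\<lambda>a. (\<alpha> a + ip (frame_trace M (f u) e) (tau *s fd f u a)) * mi (dz (coordinate_frame f u)))) (at u)"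
      (is ?deriv)
    and "pl (dz (coordinate_frame f u)) \<noteq> 0" (is ?pl) and "mi (dz (coordinate_frame f u)) \<noteq> 0" (is ?mi)
proof -
  let ?T = "tangent_space M (f u)"
  let ?\<epsilon> = "\<lambda>i. ip (e $ i) (e $ i)"
  have fM: "f u \<in> M" using local_paramD(5)[OF p] u by blast
  note ls = tangent_space_nondegenerate_lagrangian[OF sub lag nd fM]
  note T = tangent_space_param[OF p u]
  have sT: "subspace ?T" using ls by (simp add: nondegenerate_lagrangian_def)
  have eT: "e $ i \<in> ?T" for i using ordered_basis_in[OF e(1)] .
  have om: "omega v w = 0" if "v \<in> ?T" "w \<in> ?T" for v w using ls that by (simp add: nondegenerate_lagrangian_def)
  have "\<forall>i. \<exists>c. e $ i = fd f u c" using eT unfolding T by blast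
  then obtain b where b: "\<And>i. e $ i = fd f u (b i)" by metis
  have II: "second_fundamental_form M (f u) (e $ i) (e $ i) = normal_part ?T (fd2 f u (b i) (b i))" for i
    unfolding b by (rule second_fundamental_form_param[OF sub lag nd p u])
  have stT: "subspace ((*s) tau ` ?T)" using linear_subspace_image[OF linear_tau sT] .
  show ?normal
    unfolding frame_trace_def II
    by (intro subspace_sum[OF stT] subspace_scale[OF stT] nondegenerate_lagrangian_normal_part_props(1)[OF ls])
  \<comment> \<open>The trace of the cubic form over its last two slots. Total symmetry turns it
    into the trace over the first two, which is the pairing with the trace of the second fundamental
    form.\<close>
  define C where "C a = (\<Sum>i\<in>UNIV. ?\<epsilon> i * omega (fd2 f u a (b i)) (e $ i))" for a
  have ipH: "ip (frame_trace M (f u) e) (tau *s fd f u a) = C a" for a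
  proof -
    have "ip (frame_trace M (f u) e) (tau *s fd f u a)
      = (\<Sum>i\<in>UNIV. ?\<epsilon> i * ip (normal_part ?T (fd2 f u (b i) (b i))) (tau *s fd f u a))"
      unfolding frame_trace_def II by (simp add: ip_sum_left ip_scale_left)
    also have "\<dots> = (\<Sum>i\<in>UNIV. ?\<epsilon> i * omega (fd2 f u (b i) (b i)) (fd f u a))"
      using nondegenerate_lagrangian_normal_part_props(2)[OF ls, of "fd f u a"] T by simp
    also have "\<dots> = C a"
      unfolding C_def b using omega_fd2_swap[OF lag p u] fd2_symmetric[OF p u] by simp
    finally show ?thesis .
  qed
  have "\<forall>a i. \<exists>A B. fd2 f u a (b i) = (\<Sum>l\<in>UNIV. A l *\<^sub>R e $ l) + tau *s (\<Sum>l\<in>UNIV. B l *\<^sub>R e $ l)"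
  proof (intro allI)
    fix a i
    obtain s t where st: "s \<in> ?T" "t \<in> ?T" "fd2 f u a (b i) = s + tau *s t"
      by (rule nondegenerate_lagrangian_decompose[OF ls])
    obtain A where "s = (\<Sum>l\<in>UNIV. A l *\<^sub>R e $ l)" by (rule ordered_basis_span[OF e(1) st(1)])
    moreover obtain B where "t = (\<Sum>l\<in>UNIV. B l *\<^sub>R e $ l)"
      by (rule ordered_basis_span[OF e(1) st(2)])
    ultimately show "\<exists>A B. fd2 f u a (b i)
        = (\<Sum>l\<in>UNIV. A l *\<^sub>R e $ l) + tau *s (\<Sum>l\<in>UNIV. B l *\<^sub>R e $ l)"
      using st(3) by blast
  qed
  then have "\<exists>A B. \<forall>a i. fd2 f u a (b i)
      = (\<Sum>l\<in>UNIV. A a i l *\<^sub>R e $ l) + tau *s (\<Sum>l\<in>UNIV. B a i l *\<^sub>R e $ l)"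
    by (simp only: choice_iff)
  then obtain A B where AB: "\<And>a i. fd2 f u a (b i)
      = (\<Sum>l\<in>UNIV. A a i l *\<^sub>R e $ l) + tau *s (\<Sum>l\<in>UNIV. B a i l *\<^sub>R e $ l)" by blast
  \<comment> \<open>The tangential part drops out by the Lagrangian condition, the minus sign comes
    from \<open>omega_tau_left\<close>, and the square of each diagonal sign is 1. Summation over
    \<open>i\<close> gives \<open>C a = - tr B\<close>.\<close>
  have Bii: "?\<epsilon> i * omega (fd2 f u a (b i)) (e $ i) = - B a i i" for a i
  proof -
    have "omega (fd2 f u a (b i)) (e $ i) = - (\<Sum>l\<in>UNIV. B a i l * ip (e $ l) (e $ i))"
      unfolding AB omega_add_left omega_tau_left omega_sum_left omega_scale_left ip_sum_left ip_scale_left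
      using om[OF eT eT] by simp
    also have "(\<Sum>l\<in>UNIV. B a i l * ip (e $ l) (e $ i)) = (\<Sum>l\<in>UNIV. if l = i then B a i i * ?\<epsilon> i else 0)"
      using e(2) by (intro sum.cong) (auto simp: orthonormal_def)
    finally have "omega (fd2 f u a (b i)) (e $ i) = - (B a i i * ?\<epsilon> i)" by simp
    moreover have "?\<epsilon> i * ?\<epsilon> i = 1" using e(2) unfolding orthonormal_def by (metis mult_1 minus_mult_minus)
    ultimately show ?thesis by (simp add: mult.left_commute)
  qed
  define \<alpha> where "\<alpha> a = (\<Sum>i\<in>UNIV. A a i i)" for a
  \<comment> \<open>The directions \<open>b\<close> are frozen, so \<open>E\<close> is orthonormal
    only at \<open>u\<close>; in exchange it differs from the coordinate frame by a constant matrix,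
    whose determinant \<open>d\<close> divides out at the end.\<close>
  define E where "E y = (\<chi> i. fd f y (b i))" for y
  have Eu: "E u = e" by (simp add: E_def vec_eq_iff b[symmetric])
  have linpl: "bounded_linear (\<lambda>z::double ^ 'n. pl (z $ j))"
    and linmi: "bounded_linear (\<lambda>z::double ^ 'n. mi (z $ j))" for j
    by (intro linear_conv_bounded_linear[THEN iffD1] linearI; simp)+
  have "((\<lambda>y. det (\<chi> i j. pl (E y $ i $ j))) has_derivative
      (\<lambda>a. (\<Sum>i\<in>UNIV. A a i i + B a i i) * det (\<chi> i j. pl (E u $ i $ j)))) (at u)"
  proof (rule has_derivative_det_rowwise[where F'="\<lambda>i j a. pl (fd2 f u a (b i) $ j)"
        and K="\<lambda>a i l. A a i l + B a i l"])
    show "((\<lambda>y. (\<chi> i j. pl (E y $ i $ j)) $ i $ j) has_derivative (\<lambda>a. pl (fd2 f u a (b i) $ j))) (at u)" for i j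
      using bounded_linear.has_derivative[OF linpl local_paramD(7)[OF p u]] by (simp add: E_def)
    show "pl (fd2 f u a (b i) $ j) = (\<Sum>l\<in>UNIV. (A a i l + B a i l) * (\<chi> i j. pl (E u $ i $ j)) $ l $ j)" for a i j
      unfolding AB Eu by (simp add: sum.distrib distrib_right)
  qed
  then have dpl: "((\<lambda>y. pl (dz (E y))) has_derivative (\<lambda>a. (\<alpha> a - C a) * pl (dz e))) (at u)"
    unfolding Eu C_def Bii \<alpha>_def dz_def pl_det by (simp add: sum.distrib sum_negf)
  have "((\<lambda>y. det (\<chi> i j. mi (E y $ i $ j))) has_derivative
      (\<lambda>a. (\<Sum>i\<in>UNIV. A a i i - B a i i) * det (\<chi> i j. mi (E u $ i $ j)))) (at u)"
  proof (rule has_derivative_det_rowwise[where F'="\<lambda>i j a. mi (fd2 f u a (b i) $ j)"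
        and K="\<lambda>a i l. A a i l - B a i l"])
    show "((\<lambda>y. (\<chi> i j. mi (E y $ i $ j)) $ i $ j) has_derivative (\<lambda>a. mi (fd2 f u a (b i) $ j))) (at u)" for i j
      using bounded_linear.has_derivative[OF linmi local_paramD(7)[OF p u]] by (simp add: E_def)
    show "mi (fd2 f u a (b i) $ j) = (\<Sum>l\<in>UNIV. (A a i l - B a i l) * (\<chi> i j. mi (E u $ i $ j)) $ l $ j)" for a i j
      unfolding AB Eu by (simp add: sum_subtractf left_diff_distrib)
  qed
  then have dmi: "((\<lambda>y. mi (dz (E y))) has_derivative (\<lambda>a. (\<alpha> a + C a) * mi (dz e))) (at u)"
    unfolding Eu C_def Bii \<alpha>_def dz_def mi_det by (simp add: sum_subtractf sum_negf)
  define d where "d = det (\<chi> i j. b j $ i)"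
  have E: "dz (E y) = of_real d * dz (coordinate_frame f y)" if "y \<in> U" for y
    unfolding E_def d_def coordinate_frame_transform[OF local_paramD(9)[OF p that], symmetric]
    by (rule dz_transform)
  have "pl (dz e) * mi (dz e) = (- 1) ^ card {i. ?\<epsilon> i = - 1}"
    using pl_mi_dz_orthonormal[OF e(2)] om[OF eT eT] by simp
  then have "pl (dz e) * mi (dz e) \<noteq> 0" by simp
  moreover have "pl (dz e) = d * pl (dz (coordinate_frame f u))" "mi (dz e) = d * mi (dz (coordinate_frame f u))"
    using E[OF u] unfolding Eu by simp_all
  ultimately have *: "?pl \<and> ?mi \<and> d \<noteq> 0" by auto
  then show ?pl ?mi by blast+
  from * have d: "d \<noteq> 0" by blast
  have "((\<lambda>y. pl (dz (E y)) / d) has_derivative (\<lambda>a. (\<alpha> a - C a) * pl (dz e) / d)) (at u)"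
    by (rule bounded_linear.has_derivative[OF bounded_linear_divide dpl])
  then have 1: "((\<lambda>y. pl (dz (coordinate_frame f y))) has_derivative (\<lambda>a. (\<alpha> a - C a) * pl (dz e) / d)) (at u)"
    by (rule has_derivative_transform_within_open[OF _ local_paramD(1)[OF p] u]) (simp add: E d)
  have "((\<lambda>y. mi (dz (E y)) / d) has_derivative (\<lambda>a. (\<alpha> a + C a) * mi (dz e) / d)) (at u)"
    by (rule bounded_linear.has_derivative[OF bounded_linear_divide dmi])
  then have 2: "((\<lambda>y. mi (dz (coordinate_frame f y))) has_derivative (\<lambda>a. (\<alpha> a + C a) * mi (dz e) / d)) (at u)"
    by (rule has_derivative_transform_within_open[OF _ local_paramD(1)[OF p] u]) (simp add: E d)
  have e': "pl (dz e) = d * pl (dz (coordinate_frame f u))" "mi (dz e) = d * mi (dz (coordinate_frame f u))"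
    using E[OF u] unfolding Eu by simp_all
  show ?deriv
    using 1 2 d unfolding ipH e' by (intro exI[of _ \<alpha>]) (simp add: mult.commute mult.left_commute)
qed

text \<open>Independence of the frame without any change of basis: the derivatives of the two null
  components of \<open>dz\<close> do not mention the frame, and they determine
  \<open>\<alpha> - H\<close> and \<open>\<alpha> + H\<close>, hence all pairings of the trace with
  \<open>tau T\<close>.\<close>

lemma mean_curvature_frame_trace:
  fixes M :: "(double ^ 'n) set"
  assumes sub: "submanifold M" and lag: "lagrangian M" and nd: "nondegenerate_submanifold M"
    and x: "x \<in> M" and e: "ordered_basis (tangent_space M x) e" "orthonormal e"
  shows "mean_curvature M x = frame_trace M x e"
  unfolding mean_curvature_def frame_trace_def[symmetric]
proof (rule the_equality)
  show "\<exists>e'. ordered_basis (tangent_space M x) e' \<and> orthonormal e' \<and> frame_trace M x e = frame_trace M x e'"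
    using e by blast
  fix h assume "\<exists>e'. ordered_basis (tangent_space M x) e' \<and> orthonormal e' \<and> h = frame_trace M x e'"
  then obtain e' where e': "ordered_basis (tangent_space M x) e'" "orthonormal e'" and h: "h = frame_trace M x e'"
    by blast
  obtain U f u where p: "local_param M U f" and u: "u \<in> U" and xu: "x = f u"
    using sub x unfolding submanifold_def by blast
  note 1 = frame_trace_props[OF sub lag nd p u e[unfolded xu]]
  note 2 = frame_trace_props[OF sub lag nd p u e'[unfolded xu]]
  let ?P = "pl (dz (coordinate_frame f u))" and ?Q = "mi (dz (coordinate_frame f u))"
  let ?H = "\<lambda>a. ip (frame_trace M (f u) e) (tau *s fd f u a)"
  let ?H' = "\<lambda>a. ip (frame_trace M (f u) e') (tau *s fd f u a)"
  obtain \<alpha> where \<alpha>: "((\<lambda>y. pl (dz (coordinate_frame f y))) has_derivative (\<lambda>a. (\<alpha> a - ?H a) * ?P)) (at u)"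
    "((\<lambda>y. mi (dz (coordinate_frame f y))) has_derivative (\<lambda>a. (\<alpha> a + ?H a) * ?Q)) (at u)"
    using 1(2) by blast
  obtain \<alpha>' where \<alpha>': "((\<lambda>y. pl (dz (coordinate_frame f y))) has_derivative (\<lambda>a. (\<alpha>' a - ?H' a) * ?P)) (at u)"
    "((\<lambda>y. mi (dz (coordinate_frame f y))) has_derivative (\<lambda>a. (\<alpha>' a + ?H' a) * ?Q)) (at u)"
    using 2(2) by blast
  have eq: "?H a = ?H' a" for a
  proof -
    have "(\<alpha> a - ?H a) * ?P = (\<alpha>' a - ?H' a) * ?P" "(\<alpha> a + ?H a) * ?Q = (\<alpha>' a + ?H' a) * ?Q"
      using has_derivative_unique[OF \<alpha>(1) \<alpha>'(1)] has_derivative_unique[OF \<alpha>(2) \<alpha>'(2)] by meson+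
    then have "\<alpha> a - ?H a = \<alpha>' a - ?H' a" "\<alpha> a + ?H a = \<alpha>' a + ?H' a" using 1(3,4) by simp_all
    then show ?thesis by linarith
  qed
  show "h = frame_trace M x e"
    unfolding h xu
  proof (rule nondegenerate_lagrangian_normal_eqI[OF tangent_space_nondegenerate_lagrangian[OF sub lag nd x[unfolded xu]] 2(1) 1(1)])
    fix w assume "w \<in> tangent_space M (f u)"
    then show "ip (frame_trace M (f u) e') (tau *s w) = ip (frame_trace M (f u) e) (tau *s w)"
      unfolding tangent_space_param[OF p u] using eq by auto
  qed
qed

lemma local_param_mean_curvature:
  fixes M :: "(double ^ 'n) set"
  assumes sub: "submanifold M" and lag: "lagrangian M" and nd: "nondegenerate_submanifold M"
    and p: "local_param M U f" and u: "u \<in> U"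
  shows "mean_curvature M (f u) \<in> (*s) tau ` tangent_space M (f u)"
    and "\<exists>\<alpha>. ((\<lambda>y. pl (dz (coordinate_frame f y))) has_derivative
        (\<lambda>a. (\<alpha> a - ip (mean_curvature M (f u)) (tau *s fd f u a)) * pl (dz (coordinate_frame f u)))) (at u)
      \<and> ((\<lambda>y. mi (dz (coordinate_frame f y))) has_derivative
        (\<lambda>a. (\<alpha> a + ip (mean_curvature M (f u)) (tau *s fd f u a)) * mi (dz (coordinate_frame f u)))) (at u)"
    and "pl (dz (coordinate_frame f u)) \<noteq> 0" and "mi (dz (coordinate_frame f u)) \<noteq> 0"
proof -
  have fM: "f u \<in> M" using local_paramD(5)[OF p] u by blast
  note ls = tangent_space_nondegenerate_lagrangian[OF sub lag nd fM]
  obtain e where e: "ordered_basis (tangent_space M (f u)) e" "orthonormal e"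
    using orthonormal_basis_exists[of "tangent_space M (f u)"] ls unfolding nondegenerate_lagrangian_def by blast
  note * = frame_trace_props[OF sub lag nd p u e, folded mean_curvature_frame_trace[OF sub lag nd fM e]]
  show "mean_curvature M (f u) \<in> (*s) tau ` tangent_space M (f u)"
    "\<exists>\<alpha>. ((\<lambda>y. pl (dz (coordinate_frame f y))) has_derivative
        (\<lambda>a. (\<alpha> a - ip (mean_curvature M (f u)) (tau *s fd f u a)) * pl (dz (coordinate_frame f u)))) (at u)
      \<and> ((\<lambda>y. mi (dz (coordinate_frame f y))) has_derivative
        (\<lambda>a. (\<alpha> a + ip (mean_curvature M (f u)) (tau *s fd f u a)) * mi (dz (coordinate_frame f u)))) (at u)"
    "pl (dz (coordinate_frame f u)) \<noteq> 0" "mi (dz (coordinate_frame f u)) \<noteq> 0"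
    using * by blast+
qed

subsection \<open>Oriented orthonormal frames\<close>

lemma det_gram_transform:
  "det (\<chi> i k. ip (transform e A $ i) (transform e A $ k))
    = (det A)\<^sup>2 * det (\<chi> i k. ip (e $ i) (e $ k))"
  unfolding gram_transform by (simp add: det_mul det_transpose power2_eq_square)

lemma oriented_orthonormal_exists:
  fixes e0 :: "(double ^ 'n) ^ 'n"
  assumes e0: "ordered_basis V e0" and V: "nondegenerate V"
  shows "\<exists>A. det A > 0 \<and> orthonormal (transform e0 A)"
proof -
  obtain e1 where e1: "ordered_basis V e1" "orthonormal e1"
    using orthonormal_basis_exists[OF ordered_basis_subspace[OF e0] V ordered_basis_dim[OF e0]] .
  obtain A where A: "e1 = transform e0 A"
    using ordered_basis_transform_exists[OF e0 ordered_basis_in[OF e1(1)]] .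
  have "det (\<chi> i k. ip (e1 $ i) (e1 $ k)) \<noteq> 0" using det_gram_orthonormal[OF e1(2)] by simp
  then have "det A \<noteq> 0" unfolding A det_gram_transform by auto
  show ?thesis
  proof (cases "det A > 0")
    case True
    then show ?thesis using e1(2) A by blast
  next
    case False
    \<comment> \<open>Negating the vector with any one index \<open>k\<close> keeps a frame
      orthonormal and reverses its orientation.\<close>
    obtain k :: 'n where True by simp
    define D :: "real ^ 'n ^ 'n" where "D = (\<chi> i j. if i = j then (if i = k then - 1 else 1) else 0)"
    have "det D = (\<Prod>i\<in>UNIV. if i = k then - 1 else 1)"
      unfolding D_def by (subst det_diagonal) auto
    also have "\<dots> = - 1" by (subst prod.delta) auto
    finally have "det D = - 1" .
    then have "det (A ** D) > 0" using False \<open>det A \<noteq> 0\<close> by (simp add: det_mul)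
    moreover have "transform e1 D = (\<chi> j. (if j = k then - 1 else 1) *\<^sub>R e1 $ j)"
    proof -
      have "(\<Sum>i\<in>UNIV. D $ i $ j *\<^sub>R e1 $ i) = (\<Sum>i\<in>UNIV. if i = j then (if j = k then - 1 else 1) *\<^sub>R e1 $ j else 0)" for j
        unfolding D_def by (intro sum.cong) auto
      then show ?thesis unfolding transform_def by simp
    qed
    then have "orthonormal (transform e1 D)"
      using e1(2) by (simp add: orthonormal_def ip_scale_left ip_scale_right)
    ultimately show ?thesis unfolding A transform_transform by blast
  qed
qed

text \<open>A choice at each point with no continuity in \<open>x\<close>. This is harmless, since
  all oriented orthonormal bases at a point have the same value of \<open>dz\<close>.\<close>

definition oriented_frame ::
  "(double ^ 'n \<Rightarrow> ((double ^ 'n) ^ 'n) set) \<Rightarrow> double ^ 'n \<Rightarrow> (double ^ 'n) ^ 'n" where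
  "oriented_frame Or x = (SOME e. e \<in> Or x \<and> orthonormal e)"

lemma oriented_frame:
  fixes M :: "(double ^ 'n) set"
  assumes "submanifold M" "orientation M Or" "lagrangian M" "nondegenerate_submanifold M" "x \<in> M"
  shows "oriented_frame Or x \<in> Or x" "orthonormal (oriented_frame Or x)"
    "ordered_basis (tangent_space M x) (oriented_frame Or x)"
    "pl (dz (oriented_frame Or x)) * mi (dz (oriented_frame Or x))
      = (- 1) ^ card {i. ip (oriented_frame Or x $ i) (oriented_frame Or x $ i) = - 1}"
    "v \<in> Or x \<Longrightarrow> \<exists>c>0. dz v = of_real c * dz (oriented_frame Or x)"
    "(\<And>i. v $ i \<in> tangent_space M x) \<Longrightarrow>
      dz v = of_real (vol_form Or x v) * dz (oriented_frame Or x)"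
proof -
  let ?T = "tangent_space M x" and ?e = "oriented_frame Or x"
  have ls: "nondegenerate_lagrangian ?T" using tangent_space_nondegenerate_lagrangian assms by blast
  then have T: "subspace ?T" "nondegenerate ?T" "dim ?T = CARD('n)"
    and om: "\<And>v w. v \<in> ?T \<Longrightarrow> w \<in> ?T \<Longrightarrow> omega v w = 0"
    by (auto simp: nondegenerate_lagrangian_def)
  obtain e0 where e0: "ordered_basis ?T e0" and Or: "Or x = {transform e0 A | A. det A > 0}"
    using assms(2,5) unfolding orientation_def by blast
  have "\<exists>e. e \<in> Or x \<and> orthonormal e"
    using oriented_orthonormal_exists[OF e0 T(2)] unfolding Or by blast
  then have "?e \<in> Or x \<and> orthonormal ?e" unfolding oriented_frame_def by (rule someI_ex)
  then show eOr: "?e \<in> Or x" and eo: "orthonormal ?e" by blast+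
  have OrT: "e $ i \<in> ?T" if "e \<in> Or x" for e i
    using that transform_in[OF T(1) ordered_basis_in[OF e0]] unfolding Or by blast
  show eb: "ordered_basis ?T ?e"
    by (rule orthonormal_ordered_basis[OF eo T(1,3) OrT[OF eOr]])
  show N: "pl (dz ?e) * mi (dz ?e) = (- 1) ^ card {i. ip (?e $ i) (?e $ i) = - 1}"
    by (rule pl_mi_dz_orthonormal[OF eo om[OF OrT[OF eOr] OrT[OF eOr]]])
  obtain P where P: "?e = transform e0 P" "det P > 0" using eOr unfolding Or by blast
  show "\<exists>c>0. dz v = of_real c * dz ?e" if vOr: "v \<in> Or x"
  proof -
    obtain P' where P': "v = transform e0 P'" "det P' > 0" using vOr unfolding Or by blast
    have "dz v = of_real (det P' / det P) * dz ?e"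
      unfolding P' P(1) dz_transform mult.assoc[symmetric] of_real_mult[symmetric] using P(2) by simp
    then show ?thesis using P(2) P'(2) by (intro exI[of _ "det P' / det P"]) simp
  qed
  show "dz v = of_real (vol_form Or x v) * dz ?e" if vT: "\<And>i. v $ i \<in> ?T"
  proof -
    obtain A where A: "v = transform ?e A" using ordered_basis_transform_exists[OF eb vT] .
    have "vol_form Or x v = det A"
      unfolding vol_form_def
    proof (rule the_equality)
      show "\<exists>e A'. e \<in> Or x \<and> orthonormal e \<and> v = transform e A' \<and> det A = det A'"
        using eOr eo A by blast
      fix c assume "\<exists>e A'. e \<in> Or x \<and> orthonormal e \<and> v = transform e A' \<and> c = det A'"
      then obtain e' A' where e': "e' \<in> Or x" "orthonormal e'" and A': "v = transform e' A'" "c = det A'"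
        by blast
      obtain P' where P': "e' = transform e0 P'" "det P' > 0" using e'(1) unfolding Or by blast
      \<comment> \<open>The Gram determinant of an orthonormal frame has absolute value 1, so
        \<open>g\<close> fixes the square of the positive determinant that leads from
        \<open>e0\<close> to any oriented orthonormal frame. All such frames therefore share their
        \<open>dz\<close>.\<close>
      define g where "g = det (\<chi> i k. ip (e0 $ i) (e0 $ k))"
      have "\<bar>(det P)\<^sup>2 * g\<bar> = 1"
        using det_gram_orthonormal[OF eo]
        unfolding P(1) det_gram_transform g_def[symmetric] by (simp add: power_abs)
      moreover have "\<bar>(det P')\<^sup>2 * g\<bar> = 1"
        using det_gram_orthonormal[OF e'(2)]
        unfolding P'(1) det_gram_transform g_def[symmetric] by (simp add: power_abs)
      ultimately have "(det P)\<^sup>2 * \<bar>g\<bar> = (det P')\<^sup>2 * \<bar>g\<bar>" "g \<noteq> 0" by (auto simp: abs_mult)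
      then have "(det P)\<^sup>2 = (det P')\<^sup>2" by simp
      then have "det P = det P'" using P(2) P'(2) by (simp add: power2_eq_iff)
      then have "dz e' = dz ?e" unfolding P(1) P'(1) dz_transform by simp
      then have "of_real (det A') * dz ?e = of_real (det A) * dz ?e"
        using A A'(1) dz_transform by metis
      \<comment> \<open>The double numbers have zero divisors, so the cancellation takes place in
        one null component, which is nonzero by \<open>N\<close>.\<close>
      then have "pl (of_real (det A') * dz ?e) = pl (of_real (det A) * dz ?e)" by simp
      then have "det A' * pl (dz ?e) = det A * pl (dz ?e)" by simp
      moreover have "pl (dz ?e) \<noteq> 0"
      proof
        assume "pl (dz ?e) = 0"
        then have "(- 1 :: real) ^ card {i. ip (?e $ i) (?e $ i) = - 1} = 0" using N by simp
        then show False by simp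
      qed
      ultimately show "c = det A" using A'(2) by simp
    qed
    then show ?thesis using A dz_transform by metis
  qed
qed

section \<open>Local constancy of the signature\<close>

lemma bounded_bilinear_ip: "bounded_bilinear (ip :: double ^ 'n \<Rightarrow> double ^ 'n \<Rightarrow> real)"
proof -
  have "bilinear (ip :: double ^ 'n \<Rightarrow> double ^ 'n \<Rightarrow> real)"
    unfolding bilinear_def using linear_ip_left linear_ip_right by blast
  then show ?thesis by (simp only: bilinear_conv_bounded_bilinear)
qed

text \<open>Only the numbers of signs are compared: the frames are chosen independently at different
  points, so their orderings are unrelated.\<close>

definition same_signs :: "(double ^ 'n) ^ 'n \<Rightarrow> (double ^ 'n) ^ 'n \<Rightarrow> bool" where
  "same_signs e e' \<longleftrightarrow> (\<forall>\<sigma>\<in>{1, - 1}.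
    card {i. ip (e $ i) (e $ i) = \<sigma>} = card {i. ip (e' $ i) (e' $ i) = \<sigma>})"

text \<open>The orthonormal frame at \<open>u\<close> is extended with constant coefficients. Its
  Gram matrix varies continuously, so \<open>card_sign_le\<close> applies at nearby points for both
  signs; as the two counts always add up to \<open>n\<close>, the inequalities are
  equalities.\<close>

lemma same_signs_near:
  fixes M :: "(double ^ 'n) set"
  assumes sub: "submanifold M" and orn: "orientation M Or" and lag: "lagrangian M"
    and nd: "nondegenerate_submanifold M" and p: "local_param M U f" and u: "u \<in> U"
  shows "\<forall>\<^sub>F y in nhds u. same_signs (oriented_frame Or (f u)) (oriented_frame Or (f y))"
proof -
  have fM: "f y \<in> M" if "y \<in> U" for y using local_paramD(5)[OF p] that by blast
  note fr = oriented_frame[OF sub orn lag nd fM]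
  let ?e = "oriented_frame Or (f u)"
  have "\<forall>i. \<exists>c. ?e $ i = fd f u c"
    using ordered_basis_in[OF fr(3)[OF u]] unfolding tangent_space_param[OF p u] by blast
  then obtain b where b: "\<And>i. ?e $ i = fd f u (b i)" by metis
  have ev: "\<forall>\<^sub>F y in nhds u. \<bar>ip (fd f y (b i)) (fd f y (b j)) - ip (?e $ i) (?e $ j)\<bar> < 1 / (2 * CARD('n))" for i j
  proof -
    have c: "isCont (\<lambda>y. fd f y (b i)) u" for i
      using has_derivative_continuous[OF local_paramD(7)[OF p u]] .
    have "((\<lambda>y. ip (fd f y (b i)) (fd f y (b j))) \<longlongrightarrow> ip (fd f u (b i)) (fd f u (b j))) (at u)"
      using bounded_bilinear.tendsto[OF bounded_bilinear_ip] c unfolding isCont_def by blast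
    then have "((\<lambda>y. ip (fd f y (b i)) (fd f y (b j))) \<longlongrightarrow> ip (fd f u (b i)) (fd f u (b j))) (nhds u)"
      using tendsto_at_iff_tendsto_nhds[of "\<lambda>y. ip (fd f y (b i)) (fd f y (b j))" u] by blast
    from tendstoD[OF this, of "1 / (2 * CARD('n))"] show ?thesis
      unfolding b dist_real_def by simp
  qed
  have "\<forall>\<^sub>F y in nhds u. \<forall>i\<in>UNIV. \<forall>j\<in>UNIV.
      \<bar>ip (fd f y (b i)) (fd f y (b j)) - ip (?e $ i) (?e $ j)\<bar> < 1 / (2 * CARD('n))"
    by (intro eventually_ball_finite finite ballI ev)
  moreover have "\<forall>\<^sub>F y in nhds u. y \<in> U"
    using eventually_nhds_in_open[OF local_paramD(1)[OF p] u] .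
  ultimately show ?thesis
  proof eventually_elim
    case (elim y)
    let ?e' = "oriented_frame Or (f y)"
    have le: "card {i. ip (?e $ i) (?e $ i) = \<sigma>} \<le> card {i. ip (?e' $ i) (?e' $ i) = \<sigma>}"
      if "\<sigma> = 1 \<or> \<sigma> = - 1" for \<sigma>
    proof (rule card_sign_le[where E="\<chi> i. fd f y (b i)", OF fr(2)[OF u] fr(2)[OF elim(2)] fr(3)[OF elim(2)] _ _ that])
      show "(\<chi> i. fd f y (b i)) $ i \<in> tangent_space M (f y)" for i
        unfolding tangent_space_param[OF p elim(2)] by simp
    qed (use elim(1) in simp)
    show ?case
      using le[of 1] le[of "- 1"] card_sign_sum[OF fr(2)[OF u]] card_sign_sum[OF fr(2)[OF elim(2)]]
      by (auto simp: same_signs_def)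
  qed
qed

subsection \<open>Constant phase and minimality\<close>

text \<open>A constant phase makes the null components \<open>?P\<close> and \<open>?Q\<close> of
  \<open>dz\<close> proportional. Their logarithmic derivatives \<open>\<alpha> - H\<close> and
  \<open>\<alpha> + H\<close> then coincide, which leaves \<open>H = 0\<close>.\<close>

lemma constant_phase_imp_minimal:
  fixes M :: "(double ^ 'n) set"
  assumes sub: "submanifold M" and lag: "lagrangian M" and nd: "nondegenerate_submanifold M"
    and cp: "constant_phase M Or"
  shows "minimal M"
  unfolding minimal_def
proof
  fix x assume x: "x \<in> M"
  obtain \<theta> c where ph: "phase_function M Or \<theta>" and \<theta>: "\<And>x. x \<in> M \<Longrightarrow> \<theta> x = c"
    using cp unfolding constant_phase_def by blast
  obtain q s where s: "s = 1 \<or> s = - 1"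
    and eq: "\<And>x v. x \<in> M \<Longrightarrow> (\<And>i. v $ i \<in> tangent_space M x) \<Longrightarrow>
      s * tau ^ q * dz v = exp_tau (\<theta> x) * of_real (vol_form Or x v)"
    using ph unfolding phase_function_def by blast
  obtain U f u where p: "local_param M U f" and u: "u \<in> U" and xu: "x = f u"
    using sub x unfolding submanifold_def by blast
  let ?P = "\<lambda>y. pl (dz (coordinate_frame f y))" and ?Q = "\<lambda>y. mi (dz (coordinate_frame f y))"
  let ?H = "\<lambda>a. ip (mean_curvature M (f u)) (tau *s fd f u a)"
  \<comment> \<open>The quotient of the null components of the phase equation: the volume form
    cancels, as does the sign \<open>s\<close>, which has equal null components, while
    \<open>tau ^ q\<close> contributes \<open>(- 1) ^ q\<close>.\<close>
  define k where "k = (- 1) ^ q * exp (2 * c)"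
  have PQ: "?P y = k * ?Q y" if y: "y \<in> U" for y
  proof -
    let ?v = "coordinate_frame f y"
    have fM: "f y \<in> M" using local_paramD(5)[OF p] y by blast
    have "?v $ i \<in> tangent_space M (f y)" for i
      unfolding tangent_space_param[OF p y] coordinate_frame_def by simp
    then have "s * tau ^ q * dz ?v = exp_tau c * of_real (vol_form Or (f y) ?v)"
      using eq[OF fM] \<theta>[OF fM] by simp
    then have "pl (s * tau ^ q * dz ?v) = pl (exp_tau c * of_real (vol_form Or (f y) ?v))"
      "mi (s * tau ^ q * dz ?v) = mi (exp_tau c * of_real (vol_form Or (f y) ?v))" by simp_all
    then have 1: "pl s * ?P y = exp c * vol_form Or (f y) ?v"
      and 2: "mi s * (- 1) ^ q * ?Q y = exp (- c) * vol_form Or (f y) ?v" by simp_all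
    have "pl s * ?P y = exp (2 * c) * (exp (- c) * vol_form Or (f y) ?v)"
      unfolding 1 mult.assoc[symmetric] exp_add[symmetric] by simp
    also have "\<dots> = pl s * (k * ?Q y)"
      using s unfolding 2[symmetric] k_def by auto
    finally show ?thesis using s by auto
  qed
  note mc = local_param_mean_curvature[OF sub lag nd p u]
  obtain \<alpha> where dP: "(?P has_derivative (\<lambda>a. (\<alpha> a - ?H a) * ?P u)) (at u)"
    and dQ: "(?Q has_derivative (\<lambda>a. (\<alpha> a + ?H a) * ?Q u)) (at u)"
    using mc(2) by blast
  have "((\<lambda>y. k * ?Q y) has_derivative (\<lambda>a. k * ((\<alpha> a + ?H a) * ?Q u))) (at u)"
    by (rule has_derivative_mult_right[OF dQ])
  then have "(?P has_derivative (\<lambda>a. k * ((\<alpha> a + ?H a) * ?Q u))) (at u)"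
    by (rule has_derivative_transform_within_open[OF _ local_paramD(1)[OF p] u]) (simp add: PQ)
  from has_derivative_unique[OF dP this]
  have "(\<alpha> a - ?H a) * ?P u = k * ((\<alpha> a + ?H a) * ?Q u)" for a by (rule fun_cong)
  then have "(\<alpha> a - ?H a) * ?P u = (\<alpha> a + ?H a) * ?P u" for a
    unfolding PQ[OF u] by (simp only: mult.left_commute)
  then have eq: "\<alpha> a - ?H a = \<alpha> a + ?H a" for a by (simp only: mult_right_cancel[OF mc(3)])
  have H0: "?H a = 0" for a using eq[of a] by linarith
  have ls: "nondegenerate_lagrangian (tangent_space M (f u))" using tangent_space_nondegenerate_lagrangian sub lag nd x xu by blast
  show "mean_curvature M x = 0"
    unfolding xu
  proof (rule nondegenerate_lagrangian_normal_eqI[OF ls mc(1)])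
    have "0 \<in> tangent_space M (f u)" using ls subspace_0 unfolding nondegenerate_lagrangian_def by blast
    then show "0 \<in> (*s) tau ` tangent_space M (f u)" using linear_0[OF linear_tau] by (metis image_eqI)
  qed (use H0 tangent_space_param[OF p u] in auto)
qed

text \<open>For \<open>H = 0\<close> the null components of \<open>dz\<close> on the coordinate
  frame have the same logarithmic derivative, so their ratio is constant on a ball. The positive
  factor relating this frame to the orthonormal one does not affect the ratio, and the common
  signature fixes the product of the components.\<close>

lemma minimal_imp_locally_constant:
  fixes M :: "(double ^ 'n) set"
  assumes sub: "submanifold M" and orn: "orientation M Or" and lag: "lagrangian M"
    and nd: "nondegenerate_submanifold M" and min: "minimal M" and x: "x \<in> M"
  shows "\<exists>V. openin (top_of_set M) V \<and> x \<in> V \<and> (\<forall>y\<in>V.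
    dz (oriented_frame Or x) = dz (oriented_frame Or y) \<and>
    same_signs (oriented_frame Or x) (oriented_frame Or y))"
proof -
  obtain U f where p: "local_param M U f" and "x \<in> f ` U"
    and FOr: "\<And>u. u \<in> U \<Longrightarrow> coordinate_frame f u \<in> Or (f u)"
  proof -
    have "\<forall>x\<in>M. \<exists>U f. local_param M U f \<and> x \<in> f ` U \<and> (\<forall>u\<in>U. coordinate_frame f u \<in> Or (f u))"
      using orn unfolding orientation_def by (rule conjunct2)
    then show ?thesis using that x by blast
  qed
  then obtain u where u: "u \<in> U" and xu: "x = f u" by blast
  have fM: "f y \<in> M" if "y \<in> U" for y using local_paramD(5)[OF p] that by blast
  note fr = oriented_frame[OF sub orn lag nd fM]
  have "\<forall>\<^sub>F y in nhds u. y \<in> U \<and> same_signs (oriented_frame Or (f u)) (oriented_frame Or (f y))"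
    by (intro eventually_conj same_signs_near[OF sub orn lag nd p u]
        eventually_nhds_in_open[OF local_paramD(1)[OF p] u])
  then obtain r where r: "r > 0" and near: "\<And>y. y \<in> ball u r \<Longrightarrow> y \<in> U \<and> same_signs (oriented_frame Or (f u)) (oriented_frame Or (f y))"
    unfolding eventually_nhds_metric mem_ball dist_commute[of u] by blast
  let ?B = "ball u r"
  have BU: "?B \<subseteq> U" using near by blast
  have uB: "u \<in> ?B" using r by simp
  let ?P = "\<lambda>y. pl (dz (coordinate_frame f y))" and ?Q = "\<lambda>y. mi (dz (coordinate_frame f y))"
  have nz: "?P y \<noteq> 0" "?Q y \<noteq> 0" if "y \<in> ?B" for y
    using local_param_mean_curvature(3,4)[OF sub lag nd p] that BU by blast+
  have der: "\<exists>\<alpha>. (?P has_derivative (\<lambda>a. \<alpha> a * ?P y)) (at y) \<and> (?Q has_derivative (\<lambda>a. \<alpha> a * ?Q y)) (at y)"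
    if y: "y \<in> ?B" for y
  proof -
    have yU: "y \<in> U" using y BU by blast
    have "mean_curvature M (f y) = 0" using min fM[OF yU] unfolding minimal_def by blast
    then show ?thesis using local_param_mean_curvature(2)[OF sub lag nd p yU] by simp
  qed
  have "\<exists>k. \<forall>y\<in>?B. ?P y / ?Q y = k"
  proof (rule has_derivative_zero_constant[OF convex_ball])
    fix y assume y: "y \<in> ?B"
    obtain \<alpha> where "(?P has_derivative (\<lambda>a. \<alpha> a * ?P y)) (at y)" "(?Q has_derivative (\<lambda>a. \<alpha> a * ?Q y)) (at y)"
      using der[OF y] by blast
    from has_derivative_divide'[OF this nz(2)[OF y]]
    have "((\<lambda>y. ?P y / ?Q y) has_derivative (\<lambda>h. 0)) (at y)" by (simp add: mult_ac)
    then show "((\<lambda>y. ?P y / ?Q y) has_derivative (\<lambda>h. 0)) (at y within ?B)"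
      by (rule has_derivative_at_withinI)
  qed
  then obtain k where k: "\<And>y. y \<in> ?B \<Longrightarrow> ?P y = k * ?Q y" using nz(2) by (metis nonzero_eq_divide_eq)
  \<comment> \<open>Ratio and product leave open a simultaneous change of sign of both components.
    It is excluded because \<open>?P\<close> is continuous without zeros on the connected
    ball.\<close>
  have sgnP: "sgn (?P y) = sgn (?P u)" if y: "y \<in> ?B" for y
  proof -
    have "continuous_on ?B ?P"
      using der has_derivative_continuous by (intro continuous_at_imp_continuous_on) blast
    then have con: "connected (?P ` ?B)" by (rule connected_continuous_image) simp
    have "0 \<notin> ?P ` ?B" using nz(1) by fastforce
    then have "\<not> (?P y \<le> 0 \<and> 0 \<le> ?P u)" "\<not> (?P u \<le> 0 \<and> 0 \<le> ?P y)"
      using connectedD_interval[OF con imageI[OF y] imageI[OF uB]]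
        connectedD_interval[OF con imageI[OF uB] imageI[OF y]] by blast+
    then show ?thesis by (auto simp: sgn_if)
  qed
  have dzc: "dz (oriented_frame Or (f u)) = dz (oriented_frame Or (f y))" if y: "y \<in> ?B" for y
  proof -
    have yU: "y \<in> U" using y BU by blast
    define d where "d y = dz (oriented_frame Or (f y))" for y
    have dec: "\<exists>c>0. ?P y = c * pl (d y) \<and> ?Q y = c * mi (d y)" if "y \<in> ?B" for y
    proof -
      have "y \<in> U" using that BU by blast
      from fr(5)[OF this FOr[OF this]] obtain c where "c > 0" "dz (coordinate_frame f y) = of_real c * d y"
        unfolding d_def by blast
      then show ?thesis by auto
    qed
    obtain c where c: "c > 0" "?P y = c * pl (d y)" "?Q y = c * mi (d y)" using dec[OF y] by blast
    obtain c' where c': "c' > 0" "?P u = c' * pl (d u)" "?Q u = c' * mi (d u)" using dec[OF uB] by blast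
    have 1: "pl (d y) = k * mi (d y)" using k[OF y] c by simp
    have 2: "pl (d u) = k * mi (d u)" using k[OF uB] c' by simp
    have k0: "k \<noteq> 0" using k[OF uB] nz(1)[OF uB] by auto
    have 3: "sgn (pl (d y)) = sgn (pl (d u))"
      using sgnP[OF y] c c' by (simp add: sgn_mult)
    \<comment> \<open>Both products are minus one to the common number of negative signs. Multiplied
      by the common ratio \<open>k\<close> they become squares of the components \<open>pl\<close>,
      whose signs agree by \<open>3\<close>.\<close>
    have "pl (d y) * mi (d y) = pl (d u) * mi (d u)"
      unfolding d_def fr(4)[OF yU] fr(4)[OF u] using near[OF y] by (simp add: same_signs_def)
    then have "pl (d y) * (k * mi (d y)) = pl (d u) * (k * mi (d u))" by (simp add: mult.left_commute)
    then have "(pl (d y))\<^sup>2 = (pl (d u))\<^sup>2" unfolding 1[symmetric] 2[symmetric] power2_eq_square .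
    then have "\<bar>pl (d y)\<bar> = \<bar>pl (d u)\<bar>" by (simp only: power2_eq_iff abs_eq_iff)
    then have "pl (d y) = pl (d u)" using 3 by (metis abs_mult_sgn)
    moreover from this have "mi (d y) = mi (d u)" using 1 2 k0 by simp
    ultimately show ?thesis by (simp add: double_eq_pl_mi_iff d_def)
  qed
  obtain g where g: "homeomorphism U (f ` U) f g" using p unfolding local_param_def by blast
  have "openin (top_of_set U) ?B" using BU by (simp add: openin_open_eq[OF local_paramD(1)[OF p]])
  then have "openin (top_of_set (f ` U)) (f ` ?B)" by (rule homeomorphism_imp_open_map[OF g])
  then have "openin (top_of_set M) (f ` ?B)" using local_paramD(4)[OF p] openin_trans by blast
  moreover have "x \<in> f ` ?B" using xu uB by blast
  moreover have "\<forall>y\<in>f ` ?B.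
    dz (oriented_frame Or x) = dz (oriented_frame Or y) \<and>
    same_signs (oriented_frame Or x) (oriented_frame Or y)"
    unfolding xu using dzc near by blast
  ultimately show ?thesis by blast
qed

text \<open>Multiplication by \<open>tau ^ q\<close> makes the product of the null components equal
  to 1. They then have equal signs, \<open>s\<close> makes both positive, and \<open>c\<close> is
  the logarithm of the first.\<close>

lemma unit_norm_exp_tau:
  assumes "pl d * mi d = (- 1) ^ q"
  obtains s :: double and c where "s = 1 \<or> s = - 1" "s * tau ^ q * d = exp_tau c"
proof
  have nz: "pl d \<noteq> 0"
  proof
    assume "pl d = 0"
    then have "(- 1 :: real) ^ q = 0" using assms by simp
    then show False by simp
  qed
  let ?s = "if pl d > 0 then 1 else - 1 :: double"
  show "?s = 1 \<or> ?s = - 1" by simp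
  have "mi d = (- 1) ^ q / pl d" using assms nz by (simp add: field_simps)
  then have "(- 1) ^ q * mi d = 1 / pl d" by (simp add: power_mult_distrib[symmetric])
  then show "?s * tau ^ q * d = exp_tau (ln \<bar>pl d\<bar>)"
    using nz by (simp add: double_eq_pl_mi_iff exp_minus divide_inverse mult.assoc)
qed

theorem proposition16p3:
  fixes M :: "(double ^ 'n) set"
    and Or :: "double ^ 'n \<Rightarrow> ((double ^ 'n) ^ 'n) set"
  assumes "submanifold M"
    and "orientation M Or"
    and "lagrangian M"
    and "nondegenerate_submanifold M"
    and "connected M"
  shows "minimal M \<longleftrightarrow> constant_phase M Or"
proof
  assume "constant_phase M Or"
  then show "minimal M" using constant_phase_imp_minimal assms by blast
next
  assume min: "minimal M"
  have smooth: "smooth_function M (\<lambda>_. c)" for c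
    unfolding smooth_function_def o_def using smooth_on_const by blast
  let ?e = "oriented_frame Or"
  show "constant_phase M Or"
  proof (cases "M = {}")
    \<comment> \<open>There is no base point from which to read off a phase, but every condition is
      vacuous.\<close>
    case True
    have "phase_function M Or (\<lambda>_. 0)"
      unfolding phase_function_def using True smooth by blast
    then show ?thesis using True unfolding constant_phase_def by blast
  next
    case False
    then obtain x0 where x0: "x0 \<in> M" by blast
    \<comment> \<open>These are the data that determine \<open>p\<close>, \<open>q\<close>,
      \<open>s\<close> and \<open>c\<close>. Once they are constant on \<open>M\<close>, the values
      found at the base point \<open>x0\<close> serve everywhere.\<close>
    define R where "R x y \<longleftrightarrow> dz (?e x) = dz (?e y) \<and>
      same_signs (?e x) (?e y)" for x y
    have R: "R x0 x" if x: "x \<in> M" for x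
    proof (rule connected_equivalence_relation[OF assms(5) x0 x, of R])
      show "\<exists>T. openin (top_of_set M) T \<and> a \<in> T \<and> (\<forall>x\<in>T. R a x)" if "a \<in> M" for a
        unfolding R_def by (rule minimal_imp_locally_constant[OF assms(1-4) min that])
    qed (simp_all add: R_def same_signs_def)
    define p q where "p = card {i. ip (?e x0 $ i) (?e x0 $ i) = 1}"
      and "q = card {i. ip (?e x0 $ i) (?e x0 $ i) = - 1}"
    obtain s :: double and c where s: "s = 1 \<or> s = - 1" and c: "s * tau ^ q * dz (?e x0) = exp_tau c"
      using unit_norm_exp_tau[OF oriented_frame(4)[OF assms(1-4) x0]] unfolding q_def by blast
    have sig: "has_signature (tangent_space M x) p q" if x: "x \<in> M" for x
      unfolding has_signature_def
      using oriented_frame(2,3)[OF assms(1-4) x] R[OF x] unfolding R_def same_signs_def p_def q_def by auto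
    have "s * tau ^ q * dz v = exp_tau c * of_real (vol_form Or x v)"
      if x: "x \<in> M" and v: "\<forall>i. v $ i \<in> tangent_space M x" for x v
    proof -
      have "dz v = of_real (vol_form Or x v) * dz (?e x)"
        using oriented_frame(6)[OF assms(1-4) x] v by blast
      also have "dz (?e x) = dz (?e x0)" using R[OF x] by (simp add: R_def)
      finally have "s * tau ^ q * dz v = (s * tau ^ q * dz (?e x0)) * of_real (vol_form Or x v)"
        by (simp add: mult_ac)
      then show ?thesis unfolding c .
    qed
    then have "phase_function M Or (\<lambda>_. c)"
      unfolding phase_function_def using smooth sig s by blast
    then show ?thesis unfolding constant_phase_def by blast
  qed
qed

end
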